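(* Let $\Gamma$ be a connected compact metric graph with vertex set $\mathcal{V}=\mathcal{V}_{\rm N}\cup\mathcal{V}_0$ ($\mathcal{V}_0$ possibly empty), let $\lambda_1<\lambda_2$ be the first two eigenvalues of $-\Delta$ on $\Gamma$, and let $\phi_1$ be a real first eigenfunction with $\phi_1>0$ away from $\mathcal{V}_0$. Then $$\lambda_2-\lambda_1\ge\frac14\,h_{\phi_1}(\Gamma)^2 .$$
   Context: $\Gamma$ is a connected compact metric graph: finitely many edges, each identified with a compact interval of positive length, glued at a finite vertex set $\mathcal{V}$ (loops and multiple edges allowed). The vertex set is decomposed as a disjoint union $\mathcal{V}=\mathcal{V}_{\rm N}\cup\mathcal{V}_0$ (standard vertices and Dirichlet vertices). All vertices in $\mathcal{V}_0$ have degree $1$; all vertices in $\mathcal{V}_{\rm N}$ have degree $1$ or degree $\ge 3$. The operator $-\Delta$ is the self-adjoint operator on $L^2(\Gamma)$ associated to the quadratic form $\|u'\|^2$ with domain $\{u\in H^1(\Gamma): u=0 \text{ on }\mathcal{V}_0\}$, where $H^1(\Gamma)$ consists of continuous functions on $\Gamma$ that are $H^1$ on each edge; it acts as $-d^2/dx^2$ on each edge, with Dirichlet conditions on $\mathcal{V}_0$ and standard (Kirchhoff--Neumann) conditions on $\mathcal{V}_{\rm N}$: continuity, and vanishing of the sum of outgoing derivatives over the incident edges. The spectrum, listed with multiplicity, is $0\le\lambda_1<\lambda_2\le\lambda_3\le\dots$. Weighted Cheeger constant: for a continuous function $\phi:\Gamma\to\mathbb{R}$, $$h_\phi(\Gamma):=\inf\frac{\sum_{q\in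 S}\phi(q)^2}{\min\left(\int_{Y_1}\phi^2,\int_{Y_2}\phi^2\right)},$$ where the infimum is over finite subsets $S\subset\Gamma$ such that $\Gamma\setminus S$ is a disjoint union of non-empty open sets $Y_1$ and $Y_2$. *)

theory Defs
  imports
    "HOL-Analysis.Analysis"
    "HOL-Library.Function_Algebras"
    "Graph_Theory.Digraph"
begin

(* The arcs of the skeleton are the edges of the metric graph; the arc orientation only fixes which
   end of the interval [0, len e] is which.  Loops and parallel arcs are allowed. *)

record ('v, 'e) metric_graph =
  skeleton :: "('v, 'e) pre_digraph"
  len :: "'e \<Rightarrow> real"
  dirichlet :: "'v set"

abbreviation edges :: "('v, 'e) metric_graph \<Rightarrow> 'e set" where
  "edges \<Gamma> \<equiv> arcs (skeleton \<Gamma>)"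

abbreviation vertices :: "('v, 'e) metric_graph \<Rightarrow> 'v set" where
  "vertices \<Gamma> \<equiv> verts (skeleton \<Gamma>)"

(* A loop counts twice. *)
definition vertex_degree :: "('v, 'e) metric_graph \<Rightarrow> 'v \<Rightarrow> nat" where
  "vertex_degree \<Gamma> v = in_degree (skeleton \<Gamma>) v + out_degree (skeleton \<Gamma>) v"


subsection \<open>The metric graph as a topological space\<close>

(* Normal forms for the points of the quotient of the disjoint union of the intervals [0, len e]:
   a vertex, or an edge with a coordinate in the open interval. *)

datatype ('v, 'e) point = Vertex 'v | Inner 'e real

definition points :: "('v, 'e) metric_graph \<Rightarrow> ('v, 'e) point set" where
  "points \<Gamma> = Vertex ` vertices \<Gamma> \<union> {Inner e x |e x. e \<in> edges \<Gamma> \<and> 0 < x \<and> x < len \<Gamma> e}"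

(* The gluing map, meaningful for 0 \<le> x \<le> len e. *)
definition edge_point :: "('v, 'e) metric_graph \<Rightarrow> 'e \<Rightarrow> real \<Rightarrow> ('v, 'e) point" where
  "edge_point \<Gamma> e x =
     (if x = 0 then Vertex (tail (skeleton \<Gamma>) e)
      else if x = len \<Gamma> e then Vertex (head (skeleton \<Gamma>) e)
      else Inner e x)"

(* The quotient topology, i.e. the final topology for the gluing maps. *)
definition graph_topology :: "('v, 'e) metric_graph \<Rightarrow> ('v, 'e) point topology" where
  "graph_topology \<Gamma> = topology (\<lambda>U. U \<subseteq> points \<Gamma> \<and>
     (\<forall>e\<in>edges \<Gamma>. openin (top_of_set {0..len \<Gamma> e}) {x \<in> {0..len \<Gamma> e}. edge_point \<Gamma> e x \<in> U}))"

lemma openin_graph_topology: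
  "openin (graph_topology \<Gamma>) U \<longleftrightarrow> U \<subseteq> points \<Gamma> \<and>
     (\<forall>e\<in>edges \<Gamma>. openin (top_of_set {0..len \<Gamma> e}) {x \<in> {0..len \<Gamma> e}. edge_point \<Gamma> e x \<in> U})"
proof -
  let ?pre = "\<lambda>e U. {x \<in> {0..len \<Gamma> e}. edge_point \<Gamma> e x \<in> U}"
  have inter: "?pre e (S \<inter> T) = ?pre e S \<inter> ?pre e T" for e S T
    by auto
  have union: "?pre e (\<Union>\<K>) = \<Union> (?pre e ` \<K>)" for e \<K>
    by auto
  have "istopology (\<lambda>U. U \<subseteq> points \<Gamma> \<and> (\<forall>e\<in>edges \<Gamma>. openin (top_of_set {0..len \<Gamma> e}) (?pre e U)))"
    unfolding istopology_def inter union by (auto simp del: Collect_conj_eq intro!: openin_Union)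
  then show ?thesis
    unfolding graph_topology_def by (simp add: topology_inverse')
qed

(* Connectedness is that of the space.  The degree condition excludes isolated vertices. *)
definition is_metric_graph :: "('v, 'e) metric_graph \<Rightarrow> bool" where
  "is_metric_graph \<Gamma> \<longleftrightarrow>
     fin_digraph (skeleton \<Gamma>) \<and>
     vertices \<Gamma> \<noteq> {} \<and>
     (\<forall>e\<in>edges \<Gamma>. 0 < len \<Gamma> e) \<and>
     connected_space (graph_topology \<Gamma>) \<and>
     dirichlet \<Gamma> \<subseteq> vertices \<Gamma> \<and>
     (\<forall>v\<in>dirichlet \<Gamma>. vertex_degree \<Gamma> v = 1) \<and>
     (\<forall>v\<in>vertices \<Gamma> - dirichlet \<Gamma>. vertex_degree \<Gamma> v = 1 \<or> vertex_degree \<Gamma> v \<ge> 3)"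


subsection \<open>The Laplacian\<close>

definition square_integrable_on :: "(real \<Rightarrow> real) \<Rightarrow> real set \<Rightarrow> bool" where
  "square_integrable_on f A \<longleftrightarrow>
     f \<in> borel_measurable (lebesgue_on A) \<and> integrable (lebesgue_on A) (\<lambda>x. (f x)\<^sup>2)"

(* f is in H^1(0, l), represented by its continuous version on [0, l], with derivative g:
   f is absolutely continuous and its derivative g is square integrable. *)
definition has_L2_derivative :: "real \<Rightarrow> (real \<Rightarrow> real) \<Rightarrow> (real \<Rightarrow> real) \<Rightarrow> bool" where
  "has_L2_derivative l f g \<longleftrightarrow>
     square_integrable_on g {0..l} \<and>
     (\<forall>x\<in>{0..l}. f x = f 0 + (\<integral>t. g t \<partial>lebesgue_on {0..x}))"

(* The L^2 derivative is unique up to null sets, so the choice does not affect integrals. *)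
definition edge_derivative ::
    "('v, 'e) metric_graph \<Rightarrow> (('v, 'e) point \<Rightarrow> real) \<Rightarrow> 'e \<Rightarrow> real \<Rightarrow> real" where
  "edge_derivative \<Gamma> u e = (SOME g. has_L2_derivative (len \<Gamma> e) (u \<circ> edge_point \<Gamma> e) g)"

definition graph_L2 :: "('v, 'e) metric_graph \<Rightarrow> (('v, 'e) point \<Rightarrow> real) set" where
  "graph_L2 \<Gamma> = {w. \<forall>e\<in>edges \<Gamma>. square_integrable_on (w \<circ> edge_point \<Gamma> e) {0..len \<Gamma> e}}"

definition L2_inner ::
    "('v, 'e) metric_graph \<Rightarrow> (('v, 'e) point \<Rightarrow> real) \<Rightarrow> (('v, 'e) point \<Rightarrow> real) \<Rightarrow> real" where
  "L2_inner \<Gamma> w v =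
     (\<Sum>e\<in>edges \<Gamma>. \<integral>x. w (edge_point \<Gamma> e x) * v (edge_point \<Gamma> e x) \<partial>lebesgue_on {0..len \<Gamma> e})"

(* Functions are total on the type of points, so elements of H^1 are normalised to vanish outside
   the graph; equality of functions is then equality on the graph. *)
definition graph_H1 :: "('v, 'e) metric_graph \<Rightarrow> (('v, 'e) point \<Rightarrow> real) set" where
  "graph_H1 \<Gamma> = {u.
     continuous_map (graph_topology \<Gamma>) euclideanreal u \<and>
     (\<forall>e\<in>edges \<Gamma>. \<exists>g. has_L2_derivative (len \<Gamma> e) (u \<circ> edge_point \<Gamma> e) g) \<and>
     (\<forall>p. p \<notin> points \<Gamma> \<longrightarrow> u p = 0)}"

definition form_domain :: "('v, 'e) metric_graph \<Rightarrow> (('v, 'e) point \<Rightarrow> real) set" where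
  "form_domain \<Gamma> = {u \<in> graph_H1 \<Gamma>. \<forall>v\<in>dirichlet \<Gamma>. u (Vertex v) = 0}"

(* The bilinear form whose quadratic form is the squared L^2 norm of the derivative. *)
definition energy_form ::
    "('v, 'e) metric_graph \<Rightarrow> (('v, 'e) point \<Rightarrow> real) \<Rightarrow> (('v, 'e) point \<Rightarrow> real) \<Rightarrow> real" where
  "energy_form \<Gamma> u v =
     (\<Sum>e\<in>edges \<Gamma>. \<integral>x. edge_derivative \<Gamma> u e x * edge_derivative \<Gamma> v e x \<partial>lebesgue_on {0..len \<Gamma> e})"

(* The operator associated with the form, as a relation: u is in the operator domain and the
   operator maps u to (the L^2 class of) w. *)
definition neg_laplacian ::
    "('v, 'e) metric_graph \<Rightarrow> (('v, 'e) point \<Rightarrow> real) \<Rightarrow> (('v, 'e) point \<Rightarrow> real) \<Rightarrow> bool" where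
  "neg_laplacian \<Gamma> u w \<longleftrightarrow>
     u \<in> form_domain \<Gamma> \<and> w \<in> graph_L2 \<Gamma> \<and>
     (\<forall>v\<in>form_domain \<Gamma>. energy_form \<Gamma> u v = L2_inner \<Gamma> w v)"

(* This contains 0, and is {0} unless \<mu> is an eigenvalue. *)
definition eigenspace :: "('v, 'e) metric_graph \<Rightarrow> real \<Rightarrow> (('v, 'e) point \<Rightarrow> real) set" where
  "eigenspace \<Gamma> \<mu> = {u. neg_laplacian \<Gamma> u (\<lambda>p. \<mu> * u p)}"

definition eigenvalue_multiplicity :: "('v, 'e) metric_graph \<Rightarrow> real \<Rightarrow> nat" where
  "eigenvalue_multiplicity \<Gamma> \<mu> = vector_space.dim (\<lambda>(c::real) u p. c * u p) (eigenspace \<Gamma> \<mu>)"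

(* ev 1 \<le> ev 2 \<le> ... lists all eigenvalues, each as often as its multiplicity; the value ev 0 is not used.
   Finiteness is demanded because card is 0 on infinite sets. *)
definition lists_eigenvalues :: "('v, 'e) metric_graph \<Rightarrow> (nat \<Rightarrow> real) \<Rightarrow> bool" where
  "lists_eigenvalues \<Gamma> ev \<longleftrightarrow>
     mono_on {1..} ev \<and>
     (\<forall>\<mu>. finite {k. 1 \<le> k \<and> ev k = \<mu>} \<and> card {k. 1 \<le> k \<and> ev k = \<mu>} = eigenvalue_multiplicity \<Gamma> \<mu>)"

interpretation point_functions: vector_space "\<lambda>(c::real) (u :: ('v, 'e) point \<Rightarrow> real) p. c * u p"
  by unfold_locales (auto simp: fun_eq_iff algebra_simps)


subsection \<open>The weighted Cheeger constant\<close>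

definition integral_over ::
    "('v, 'e) metric_graph \<Rightarrow> ('v, 'e) point set \<Rightarrow> (('v, 'e) point \<Rightarrow> real) \<Rightarrow> real" where
  "integral_over \<Gamma> Y f =
     (\<Sum>e\<in>edges \<Gamma>. \<integral>x. f (edge_point \<Gamma> e x) \<partial>lebesgue_on {x \<in> {0..len \<Gamma> e}. edge_point \<Gamma> e x \<in> Y})"

definition is_cut ::
    "('v, 'e) metric_graph \<Rightarrow> ('v, 'e) point set \<Rightarrow> ('v, 'e) point set \<Rightarrow> ('v, 'e) point set \<Rightarrow> bool" where
  "is_cut \<Gamma> S Y\<^sub>1 Y\<^sub>2 \<longleftrightarrow>
     finite S \<and> S \<subseteq> points \<Gamma> \<and>
     openin (graph_topology \<Gamma>) Y\<^sub>1 \<and> openin (graph_topology \<Gamma>) Y\<^sub>2 \<and> Y\<^sub>1 \<noteq> {} \<and> Y\<^sub>2 \<noteq> {} \<and>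
     Y\<^sub>1 \<inter> Y\<^sub>2 = {} \<and> points \<Gamma> - S = Y\<^sub>1 \<union> Y\<^sub>2"

(* The denominators are positive when \<phi> is nonzero at all but finitely many points; otherwise a
   vanishing denominator would yield the quotient 0 rather than infinity. *)
definition cheeger :: "('v, 'e) metric_graph \<Rightarrow> (('v, 'e) point \<Rightarrow> real) \<Rightarrow> real" where
  "cheeger \<Gamma> \<phi> =
     Inf {(\<Sum>q\<in>S. (\<phi> q)\<^sup>2) /
          min (integral_over \<Gamma> Y\<^sub>1 (\<lambda>p. (\<phi> p)\<^sup>2)) (integral_over \<Gamma> Y\<^sub>2 (\<lambda>p. (\<phi> p)\<^sup>2)) |S Y\<^sub>1 Y\<^sub>2.
          is_cut \<Gamma> S Y\<^sub>1 Y\<^sub>2}"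

end

theory Submission
  imports Defs
begin

text \<open>
  This is Cheeger's argument for the ground state transform. Let \<open>\<phi>\<close> be the positive first eigenfunction,
  \<open>\<psi>\<close> an eigenfunction to the second eigenvalue \<open>\<mu>\<^sub>2 > \<mu>\<^sub>1\<close>, and \<open>f = \<psi> / \<phi>\<close>. As \<open>\<psi>\<close> is orthogonal to \<open>\<phi>\<close>, it
  changes sign; replacing it by \<open>- \<psi>\<close> if necessary, the region \<open>\<psi> > 0\<close> has at most the \<open>\<phi>\<^sup>2\<close>-mass of the
  region \<open>\<psi> < 0\<close>. Write \<open>f\<^sub>+\<close> and \<open>\<psi>\<^sub>+\<close> for positive parts and \<open>A\<close> for \<open>\<integral> \<psi>\<^sub>+\<^sup>2 = \<integral> \<phi>\<^sup>2 f\<^sub>+\<^sup>2\<close>.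

  Picone's identity bounds the energy (\<open>picone_energy\<close>): the integral of \<open>\<phi>\<^sup>2 f'\<^sup>2\<close> over \<open>\<psi> > 0\<close> is at most
  \<open>(\<mu>\<^sub>2 - \<mu>\<^sub>1) A\<close>.

  For \<open>t > 0\<close> the level \<open>f\<^sup>2 = t\<close>, \<open>f > 0\<close> is finite (\<open>finite_level\<close>, a Sturm comparison) and cuts the graph
  into \<open>\<psi> > \<phi> \<surd>t\<close> and \<open>\<psi> < \<phi> \<surd>t\<close>, the first of which has no more mass than the second. So \<open>h\<close> times the mass of
  \<open>\<psi> > \<phi> \<surd>t\<close> is at most the sum of \<open>\<phi>\<^sup>2\<close> over the level (\<open>cheeger_level\<close>). Integrating over \<open>t\<close>, the left
  side becomes \<open>h A\<close> (\<open>layer_cake\<close>), and by the coarea inequality (\<open>coarea_inequality\<close>) the right side is at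
  most \<open>\<integral> \<phi>\<^sup>2 \<bar>(f\<^sub>+\<^sup>2)'\<bar> = \<integral> 2 \<phi>\<^sup>2 f\<^sub>+ \<bar>f'\<bar>\<close>. By Young's inequality and the energy bound this is at most
  \<open>c A + (\<mu>\<^sub>2 - \<mu>\<^sub>1) A / c\<close> for every \<open>c > 0\<close>; with \<open>c\<^sup>2 = \<mu>\<^sub>2 - \<mu>\<^sub>1\<close> one obtains \<open>h \<le> 2 c\<close>.

  All this is calculus on the edges, because eigenfunctions are classical solutions there
  (\<open>eigenfunction_classical\<close>). Besides positivity of \<open>\<phi>\<close>, only the weak form of the eigenvalue equations
  enters, and no variational characterisation of the eigenvalues.
\<close>

section \<open>Absolutely continuous functions with square integrable derivative\<close>

lemma L2_derivative_integrable:
  assumes "has_L2_derivative l f g"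
  shows "integrable (lebesgue_on {0..l}) g"
proof -
  let ?M = "lebesgue_on {0..l}"
  interpret finite_measure ?M by (rule finite_measure_lebesgue_on) auto
  have [measurable]: "g \<in> borel_measurable ?M" and sq: "integrable ?M (\<lambda>x. (g x)\<^sup>2)"
    using assms unfolding has_L2_derivative_def square_integrable_on_def by auto
  show ?thesis
  proof (rule Bochner_Integration.integrable_bound)
    show "integrable ?M (\<lambda>x. 1 + (g x)\<^sup>2)" using sq by simp
    have "\<bar>y\<bar> \<le> 1 + y\<^sup>2" for y :: real
    proof -
      have "0 \<le> (\<bar>y\<bar> - 1)\<^sup>2" by simp
      then have "2 * \<bar>y\<bar> \<le> 1 + y\<^sup>2" by (simp add: power2_diff)
      then show ?thesis by linarith
    qed
    then show "AE x in ?M. norm (g x) \<le> norm (1 + (g x)\<^sup>2)" by auto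
  qed simp
qed

text \<open>By Lebesgue's differentiation theorem an integrable function is almost everywhere the derivative
  of its primitive, so a vanishing primitive forces the function to vanish almost everywhere.\<close>

lemma zero_primitive_imp_AE_zero:
  fixes g :: "real \<Rightarrow> real"
  assumes g: "integrable (lebesgue_on {0..l}) g"
    and zero: "\<And>x. x \<in> {0..l} \<Longrightarrow> (\<integral>t. g t \<partial>lebesgue_on {0..x}) = 0"
  shows "AE x in lebesgue_on {0..l}. g x = 0"
proof -
  define f where "f = (\<lambda>x. if x \<in> {0..l} then g x else 0)"
  have gi: "g integrable_on {0..l}"
    using g by (simp add: integrable_on_lebesgue_on)
  have "f integrable_on UNIV"
    unfolding f_def using gi integrable_restrict_UNIV by blast
  then have fi: "f integrable_on cbox a b" for a b
    by (rule integrable_on_subcbox) auto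
  obtain N where N: "negligible N" and lim: "\<And>x e. \<lbrakk>x \<notin> N; 0 < e\<rbrakk> \<Longrightarrow>
     \<exists>d>0. \<forall>h. 0 < h \<and> h < d \<longrightarrow>
        norm (integral (cbox x (x + h *\<^sub>R One)) f /\<^sub>R h ^ DIM(real) - f x) < e"
    by (rule integrable_ccontinuous_explicit[OF fi]) blast
  have z: "integral {0..x} g = 0" if "x \<in> {0..l}" for x
  proof -
    have "integrable (lebesgue_on {0..x}) g"
      by (rule integrable_subinterval[OF g]) (use that in auto)
    with zero[OF that] show ?thesis by (simp add: lebesgue_integral_eq_integral)
  qed
  have "g x = 0" if x: "x \<in> {0..<l}" "x \<notin> N" for x
  proof (rule ccontr)
    assume "g x \<noteq> 0"
    then obtain d where d: "d > 0"
      and h: "\<And>h. \<lbrakk>0 < h; h < d\<rbrakk> \<Longrightarrow> norm (integral {x..x + h} f / h - f x) < \<bar>g x\<bar>"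
      using lim[of x "\<bar>g x\<bar>"] x by (auto simp: divide_inverse mult.commute)
    define h where "h = min (d / 2) (l - x)"
    have hh: "0 < h" "h < d" "x + h \<le> l" using d x by (auto simp: h_def)
    have "integral {x..x + h} f = integral {x..x + h} g"
      by (rule integral_cong) (use x hh in \<open>auto simp: f_def\<close>)
    moreover have "integral {0..x} g + integral {x..x + h} g = integral {0..x + h} g"
      by (rule Henstock_Kurzweil_Integration.integral_combine)
         (use x hh integrable_subinterval_real[OF gi] in auto)
    ultimately have "integral {x..x + h} f = 0" using z[of x] z[of "x + h"] x hh by auto
    with h[of h] hh x show False by (auto simp: f_def)
  qed
  moreover have "N \<union> {l} \<in> null_sets lebesgue"
    using N negligible_iff_null_sets by auto
  ultimately have "AE x in lebesgue. x \<in> {0..l} \<longrightarrow> g x = 0"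
    by (intro AE_I'[of "N \<union> {l}"]) (auto simp: le_less)
  then show ?thesis
    by (simp add: AE_restrict_space_iff)
qed

lemma L2_derivative_unique:
  assumes "has_L2_derivative l f g" "has_L2_derivative l f g'"
  shows "AE x in lebesgue_on {0..l}. g x = g' x"
proof -
  have i: "integrable (lebesgue_on {0..l}) g" "integrable (lebesgue_on {0..l}) g'"
    using assms by (auto intro: L2_derivative_integrable)
  have "AE x in lebesgue_on {0..l}. g x - g' x = 0"
  proof (rule zero_primitive_imp_AE_zero)
    fix x assume x: "x \<in> {0..l}"
    have "integrable (lebesgue_on {0..x}) g" "integrable (lebesgue_on {0..x}) g'"
      by (rule integrable_subinterval[OF i(1)] integrable_subinterval[OF i(2)]; use x in auto)+
    then have "(\<integral>t. g t - g' t \<partial>lebesgue_on {0..x})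
        = (\<integral>t. g t \<partial>lebesgue_on {0..x}) - (\<integral>t. g' t \<partial>lebesgue_on {0..x})" by simp
    moreover have "f x = f 0 + (\<integral>t. g t \<partial>lebesgue_on {0..x})"
      and "f x = f 0 + (\<integral>t. g' t \<partial>lebesgue_on {0..x})"
      using assms x unfolding has_L2_derivative_def by blast+
    ultimately show "(\<integral>t. g t - g' t \<partial>lebesgue_on {0..x}) = 0" by linarith
  qed (use i in auto)
  then show ?thesis by simp
qed

lemma integrable_continuous_lebesgue_on:
  fixes f :: "real \<Rightarrow> real"
  assumes "continuous_on {a..b} f"
  shows "integrable (lebesgue_on {a..b}) f"
  by (rule continuous_imp_integrable_real[OF assms])

lemma integral_FTC_lebesgue_on:
  fixes F f :: "real \<Rightarrow> real"
  assumes "a \<le> b" "continuous_on {a..b} f"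
    and "\<And>x. x \<in> {a..b} \<Longrightarrow> (F has_real_derivative f x) (at x within {a..b})"
  shows "(\<integral>x. f x \<partial>lebesgue_on {a..b}) = F b - F a"
proof -
  have "(\<integral>x. f x \<partial>lebesgue_on {a..b}) = integral {a..b} f"
    by (rule lebesgue_integral_eq_integral) (use assms integrable_continuous_lebesgue_on in auto)
  also have "\<dots> = F b - F a"
    by (intro integral_unique fundamental_theorem_of_calculus)
       (use assms in \<open>auto simp: has_real_derivative_iff_has_vector_derivative\<close>)
  finally show ?thesis .
qed

lemma C1_has_L2_derivative:
  fixes f f' :: "real \<Rightarrow> real"
  assumes cont: "continuous_on {0..l} f'"
    and deriv: "\<And>x. x \<in> {0..l} \<Longrightarrow> (f has_real_derivative f' x) (at x within {0..l})"
  shows "has_L2_derivative l f f'"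
  unfolding has_L2_derivative_def square_integrable_on_def
proof (intro conjI ballI)
  show "f' \<in> borel_measurable (lebesgue_on {0..l})"
    using integrable_continuous_lebesgue_on[OF cont] by auto
  show "integrable (lebesgue_on {0..l}) (\<lambda>x. (f' x)\<^sup>2)"
    by (intro integrable_continuous_lebesgue_on continuous_intros cont)
  fix x assume x: "x \<in> {0..l}"
  have "(\<integral>t. f' t \<partial>lebesgue_on {0..x}) = f x - f 0"
  proof (rule integral_FTC_lebesgue_on)
    show "continuous_on {0..x} f'" by (rule continuous_on_subset[OF cont]) (use x in auto)
    show "(f has_real_derivative f' y) (at y within {0..x})" if "y \<in> {0..x}" for y
      by (rule has_field_derivative_subset[OF deriv]) (use x that in auto)
  qed (use x in auto)
  then show "f x = f 0 + (\<integral>t. f' t \<partial>lebesgue_on {0..x})" by simp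
qed

lemma integrable_mult_continuous:
  fixes f p :: "real \<Rightarrow> real"
  assumes f: "integrable (lebesgue_on {a..b}) f" and p: "continuous_on {a..b} p"
  shows "integrable (lebesgue_on {a..b}) (\<lambda>x. f x * p x)"
proof -
  obtain B where "\<forall>y\<in>p ` {a..b}. norm y \<le> B"
    using compact_imp_bounded[OF compact_continuous_image[OF p compact_Icc]]
    unfolding bounded_iff by blast
  then have B: "\<bar>p x\<bar> \<le> B" if "x \<in> {a..b}" for x
    using that by auto
  have [measurable]: "p \<in> borel_measurable (lebesgue_on {a..b})"
    by (rule borel_measurable_integrable[OF integrable_continuous_lebesgue_on[OF p]])
  note [measurable] = borel_measurable_integrable[OF f]
  show ?thesis
  proof (rule Bochner_Integration.integrable_bound)
    show "integrable (lebesgue_on {a..b}) (\<lambda>x. B * f x)" using f by simp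
    have "norm (f x * p x) \<le> norm (B * f x)" if "x \<in> {a..b}" for x
      using mult_left_mono[OF order_trans[OF B[OF that] abs_ge_self[of B]], of "\<bar>f x\<bar>"]
      by (simp add: abs_mult mult.commute)
    then show "AE x in lebesgue_on {a..b}. norm (f x * p x) \<le> norm (B * f x)"
      by (intro AE_I2) simp
  qed simp
qed

text \<open>Integration by parts of an absolutely continuous function against a \<open>C\<^sup>1\<close> function, by Fubini's
  theorem on the triangle \<open>t \<le> x\<close>.\<close>

lemma L2_derivative_by_parts:
  fixes p q d g :: "real \<Rightarrow> real"
  assumes d: "has_L2_derivative l d g" and d0: "d 0 = 0" and dl: "d l = 0" and l: "0 < l"
    and q: "continuous_on {0..l} q"
    and p: "\<And>x. x \<in> {0..l} \<Longrightarrow> (p has_real_derivative q x) (at x within {0..l})"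
  shows "(\<integral>x. g x * p x \<partial>lebesgue_on {0..l}) = - (\<integral>x. d x * q x \<partial>lebesgue_on {0..l})"
proof -
  define M where "M = lebesgue_on {0..l}"
  interpret finite_measure M unfolding M_def by (rule finite_measure_lebesgue_on) auto
  interpret P: pair_sigma_finite M M ..
  have g: "integrable M g" unfolding M_def by (rule L2_derivative_integrable[OF d])
  have qi: "integrable M q" unfolding M_def by (rule integrable_continuous_lebesgue_on[OF q])
  note [measurable] = borel_measurable_integrable[OF g] borel_measurable_integrable[OF qi]
  have [measurable]: "(\<lambda>x. x) \<in> borel_measurable M"
    unfolding M_def using id_borel_measurable_lebesgue_on[of "{0..l}"] by (simp add: id_def)
  have space: "space M = {0..l}" by (simp add: M_def)
  have dx: "d x = (\<integral>t. g t \<partial>lebesgue_on {0..x})" if "x \<in> {0..l}" for x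
    using d d0 that unfolding has_L2_derivative_def by simp
  have "integrable (M \<Otimes>\<^sub>M M) (\<lambda>z. g (fst z) * q (snd z))"
  proof (rule P.Fubini_integrable)
    show "integrable M (\<lambda>x. LINT y|M. norm (g (fst (x, y)) * q (snd (x, y))))"
      using g by (simp add: abs_mult)
  qed (use qi in auto)
  then have F: "integrable (M \<Otimes>\<^sub>M M) (\<lambda>(t, x). if t \<le> x then g t * q x else 0)"
    by (rule Bochner_Integration.integrable_bound) auto
  have inner1: "(\<integral>x. (if t \<le> x then g t * q x else 0) \<partial>M) = g t * (p l - p t)"
    if t: "t \<in> {0..l}" for t
  proof -
    have "(\<integral>x. (if t \<le> x then g t * q x else 0) \<partial>M)
        = (\<integral>x. (if x \<in> {t..l} then g t * q x else 0) \<partial>M)"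
      by (rule Bochner_Integration.integral_cong) (auto simp: space)
    also have "\<dots> = (\<integral>x. g t * q x \<partial>lebesgue_on {t..l})"
      unfolding M_def by (rule integral_restrict) (use t in auto)
    also have "\<dots> = g t * (\<integral>x. q x \<partial>lebesgue_on {t..l})" by simp
    also have "(\<integral>x. q x \<partial>lebesgue_on {t..l}) = p l - p t"
    proof (rule integral_FTC_lebesgue_on)
      show "continuous_on {t..l} q" by (rule continuous_on_subset[OF q]) (use t in auto)
      show "(p has_real_derivative q x) (at x within {t..l})" if "x \<in> {t..l}" for x
        by (rule has_field_derivative_subset[OF p]) (use t that in auto)
    qed (use t in auto)
    finally show ?thesis .
  qed
  have inner2: "(\<integral>t. (if t \<le> x then g t * q x else 0) \<partial>M) = d x * q x"
    if x: "x \<in> {0..l}" for x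
  proof -
    have "(\<integral>t. (if t \<le> x then g t * q x else 0) \<partial>M)
        = (\<integral>t. (if t \<in> {0..x} then g t * q x else 0) \<partial>M)"
      by (rule Bochner_Integration.integral_cong) (auto simp: space)
    also have "\<dots> = (\<integral>t. g t * q x \<partial>lebesgue_on {0..x})"
      unfolding M_def by (rule integral_restrict) (use x in auto)
    also have "\<dots> = d x * q x" using dx[OF x] by simp
    finally show ?thesis .
  qed
  have pc: "continuous_on {0..l} p"
    by (rule DERIV_continuous_on[OF p])
  have pi: "integrable M (\<lambda>x. g x * p x)"
    using integrable_mult_continuous[OF _ pc] g by (simp add: M_def)
  have "(\<integral>x. d x * q x \<partial>M) = (\<integral>x. \<integral>t. (if t \<le> x then g t * q x else 0) \<partial>M \<partial>M)"
    by (rule Bochner_Integration.integral_cong) (auto simp: space inner2)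
  also have "\<dots> = (\<integral>t. \<integral>x. (if t \<le> x then g t * q x else 0) \<partial>M \<partial>M)"
    by (rule P.Fubini_integral[OF F])
  also have "\<dots> = (\<integral>t. p l * g t - g t * p t \<partial>M)"
    by (rule Bochner_Integration.integral_cong) (auto simp: space inner1 algebra_simps)
  also have "\<dots> = p l * (\<integral>t. g t \<partial>M) - (\<integral>t. g t * p t \<partial>M)"
    using g pi by simp
  also have "(\<integral>t. g t \<partial>M) = 0"
    using dx[of l] dl l by (simp add: M_def)
  finally show ?thesis by (simp add: M_def)
qed

lemma L2_derivative_continuous:
  assumes "has_L2_derivative l f g"
  shows "continuous_on {0..l} f"
proof -
  have "continuous_on {0..l} (\<lambda>x. f 0 + (\<integral>t. g t \<partial>lebesgue_on {0..x}))"
    by (intro continuous_intros indefinite_integral_continuous_real L2_derivative_integrable[OF assms])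
  moreover have "\<forall>x\<in>{0..l}. f x = f 0 + (\<integral>t. g t \<partial>lebesgue_on {0..x})"
    using assms unfolding has_L2_derivative_def by blast
  ultimately show ?thesis
    by (metis (no_types, lifting) continuous_on_cong)
qed

lemma continuous_primitive:
  fixes f :: "real \<Rightarrow> real"
  assumes f: "continuous_on {0..l} f"
  obtains F where "\<And>x. x \<in> {0..l} \<Longrightarrow> (F has_real_derivative f x) (at x within {0..l})"
proof
  show "((\<lambda>x. integral {0..x} f) has_real_derivative f x) (at x within {0..l})"
    if "x \<in> {0..l}" for x
    using integral_has_real_derivative[OF f that] .
qed

lemma L2_derivative_diff:
  assumes u: "has_L2_derivative l u g" and v: "has_L2_derivative l v h"
  shows "has_L2_derivative l (\<lambda>x. u x - v x) (\<lambda>x. g x - h x)"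
  unfolding has_L2_derivative_def square_integrable_on_def
proof (intro conjI ballI)
  let ?M = "lebesgue_on {0..l}"
  have [measurable]: "g \<in> borel_measurable ?M" "h \<in> borel_measurable ?M"
    and sq: "integrable ?M (\<lambda>x. (g x)\<^sup>2)" "integrable ?M (\<lambda>x. (h x)\<^sup>2)"
    using u v unfolding has_L2_derivative_def square_integrable_on_def by auto
  show "(\<lambda>x. g x - h x) \<in> borel_measurable ?M" by simp
  show "integrable ?M (\<lambda>x. (g x - h x)\<^sup>2)"
  proof (rule Bochner_Integration.integrable_bound)
    show "integrable ?M (\<lambda>x. 2 * (g x)\<^sup>2 + 2 * (h x)\<^sup>2)" using sq by simp
    have "(a - b)\<^sup>2 \<le> 2 * a\<^sup>2 + 2 * b\<^sup>2" for a b :: real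
      using zero_le_power2[of "a + b"] unfolding power2_diff power2_sum by linarith
    then show "AE x in ?M. norm ((g x - h x)\<^sup>2) \<le> norm (2 * (g x)\<^sup>2 + 2 * (h x)\<^sup>2)"
      by simp
  qed simp
  fix x assume x: "x \<in> {0..l}"
  have "integrable (lebesgue_on {0..x}) g" "integrable (lebesgue_on {0..x}) h"
    by (rule integrable_subinterval[OF L2_derivative_integrable[OF u]]
        integrable_subinterval[OF L2_derivative_integrable[OF v]]; use x in auto)+
  then have "(\<integral>t. g t - h t \<partial>lebesgue_on {0..x})
      = (\<integral>t. g t \<partial>lebesgue_on {0..x}) - (\<integral>t. h t \<partial>lebesgue_on {0..x})" by simp
  moreover have "u x = u 0 + (\<integral>t. g t \<partial>lebesgue_on {0..x})"
    and "v x = v 0 + (\<integral>t. h t \<partial>lebesgue_on {0..x})"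
    using u v x unfolding has_L2_derivative_def by blast+
  ultimately show "u x - v x = u 0 - v 0 + (\<integral>t. g t - h t \<partial>lebesgue_on {0..x})"
    by linarith
qed

text \<open>The du Bois-Reymond argument. Let \<open>w\<close> be the classical solution of \<open>w'' = - \<mu> u\<close> with the boundary
  values of \<open>u\<close>. Then \<open>d = u - w\<close> is an admissible test function, and testing with it gives
  \<open>\<integral> d'\<^sup>2 = 0\<close>; so \<open>u = w\<close>.\<close>

lemma weak_solution_classical:
  fixes u g :: "real \<Rightarrow> real"
  assumes u: "has_L2_derivative l u g" and l: "0 < l"
    and weak: "\<And>d h. \<lbrakk>has_L2_derivative l d h; d 0 = 0; d l = 0\<rbrakk> \<Longrightarrow>
      (\<integral>x. g x * h x \<partial>lebesgue_on {0..l}) = \<mu> * (\<integral>x. u x * d x \<partial>lebesgue_on {0..l})"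
  obtains u' where
    "\<And>x. x \<in> {0..l} \<Longrightarrow> (u has_real_derivative u' x) (at x within {0..l})"
    "\<And>x. x \<in> {0..l} \<Longrightarrow> (u' has_real_derivative - \<mu> * u x) (at x within {0..l})"
proof -
  let ?M = "lebesgue_on {0..l}"
  have uc: "continuous_on {0..l} u" by (rule L2_derivative_continuous[OF u])
  obtain P where P: "\<And>x. x \<in> {0..l} \<Longrightarrow> (P has_real_derivative - \<mu> * u x) (at x within {0..l})"
    by (rule continuous_primitive[of l "\<lambda>x. - \<mu> * u x"]) (intro continuous_intros uc, blast)
  have Pc: "continuous_on {0..l} P" by (rule DERIV_continuous_on[OF P])
  obtain R where R: "\<And>x. x \<in> {0..l} \<Longrightarrow> (R has_real_derivative P x) (at x within {0..l})"
    by (rule continuous_primitive[OF Pc]) blast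
  \<comment> \<open>the slope that makes \<open>w\<close> agree with \<open>u\<close> at \<open>l\<close>\<close>
  define c where "c = ((u l - u 0) - (R l - R 0)) / l"
  define w where "w = (\<lambda>x. u 0 + (R x - R 0) + c * x)"
  define w' where "w' = (\<lambda>x. P x + c)"
  have w: "(w has_real_derivative w' x) (at x within {0..l})" if "x \<in> {0..l}" for x
    unfolding w_def w'_def by (auto intro!: derivative_eq_intros R[OF that])
  have w': "(w' has_real_derivative - \<mu> * u x) (at x within {0..l})" if "x \<in> {0..l}" for x
    unfolding w'_def by (auto intro!: derivative_eq_intros P[OF that])
  have w'c: "continuous_on {0..l} w'" by (rule DERIV_continuous_on[OF w'])
  have wL: "has_L2_derivative l w w'" by (rule C1_has_L2_derivative[OF w'c w])
  define d where "d = (\<lambda>x. u x - w x)"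
  define h where "h = (\<lambda>x. g x - w' x)"
  have d: "has_L2_derivative l d h" unfolding d_def h_def by (rule L2_derivative_diff[OF u wL])
  have d0: "d 0 = 0" "d l = 0" using l by (auto simp: d_def w_def c_def)
  have dc: "continuous_on {0..l} d" by (rule L2_derivative_continuous[OF d])
  have [measurable]: "g \<in> borel_measurable ?M" "h \<in> borel_measurable ?M"
    and h2: "integrable ?M (\<lambda>x. (h x)\<^sup>2)" and hi: "integrable ?M h"
    using u d L2_derivative_integrable[OF d]
    unfolding has_L2_derivative_def square_integrable_on_def by auto
  have 1: "(\<integral>x. g x * h x \<partial>?M) = \<mu> * (\<integral>x. u x * d x \<partial>?M)"
    by (rule weak[OF d d0])
  have 2: "(\<integral>x. h x * w' x \<partial>?M) = \<mu> * (\<integral>x. u x * d x \<partial>?M)"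
  proof -
    have "(\<integral>x. h x * w' x \<partial>?M) = - (\<integral>x. d x * (- \<mu> * u x) \<partial>?M)"
      by (rule L2_derivative_by_parts[OF d d0 l _ w']) (auto intro!: continuous_intros uc)
    also have "\<dots> = - (\<integral>x. - \<mu> * (u x * d x) \<partial>?M)"
      by (simp add: algebra_simps)
    finally show ?thesis by simp
  qed
  have hw: "integrable ?M (\<lambda>x. h x * w' x)"
    by (rule integrable_mult_continuous[OF hi w'c])
  have "(\<integral>x. (h x)\<^sup>2 \<partial>?M) = (\<integral>x. g x * h x \<partial>?M) - (\<integral>x. h x * w' x \<partial>?M)"
  proof -
    have "(\<integral>x. g x * h x \<partial>?M) = (\<integral>x. (h x)\<^sup>2 + h x * w' x \<partial>?M)"
      by (simp add: h_def power2_eq_square algebra_simps)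
    also have "\<dots> = (\<integral>x. (h x)\<^sup>2 \<partial>?M) + (\<integral>x. h x * w' x \<partial>?M)"
      using h2 hw by simp
    finally show ?thesis by simp
  qed
  then have "(\<integral>x. (h x)\<^sup>2 \<partial>?M) = 0" using 1 2 by simp
  then have h0: "AE x in ?M. h x = 0"
    using h2 by (simp add: integral_nonneg_eq_0_iff_AE)
  have uw: "u x = w x" if x: "x \<in> {0..l}" for x
  proof -
    have "AE t in lebesgue_on {0..x}. h t = 0"
      using h0 x by (auto simp: AE_restrict_space_iff)
    then have "(\<integral>t. h t \<partial>lebesgue_on {0..x}) = 0" by (rule integral_eq_zero_AE)
    moreover have "d x = d 0 + (\<integral>t. h t \<partial>lebesgue_on {0..x})"
      using d x unfolding has_L2_derivative_def by blast
    ultimately show ?thesis using d0 by (simp add: d_def)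
  qed
  show thesis
  proof (rule that[of w'])
    show "(u has_real_derivative w' x) (at x within {0..l})" if x: "x \<in> {0..l}" for x
      by (rule has_field_derivative_transform_within[OF w[OF x], of 1]) (use x uw in auto)
  qed (use w' in auto)
qed

section \<open>Finiteness of zero sets\<close>

lemma infinite_three_increasing:
  fixes A :: "'a :: linorder set"
  assumes "infinite A"
  obtains a b c where "a \<in> A" "b \<in> A" "c \<in> A" "a < b" "b < c"
proof -
  obtain T where T: "T \<subseteq> A" "card T = 3" "finite T"
    using infinite_arbitrarily_large[OF assms] by metis
  define xs where "xs = sorted_list_of_set T"
  have "length xs = 3" "sorted_wrt (<) xs" "set xs = T"
    using T by (auto simp: xs_def)
  then obtain a b c where "xs = [a, b, c]"
    by (auto simp: numeral_3_eq_3 length_Suc_conv)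
  with \<open>sorted_wrt (<) xs\<close> \<open>set xs = T\<close> T(1) show thesis
    by (intro that[of a b c]) auto
qed

text \<open>A Sturm comparison. Near an accumulation point \<open>m\<close> of zeros, divide \<open>D\<close> by the positive solution
  \<open>w = cos (\<omega> (x - m))\<close> of \<open>w'' + \<kappa> w = 0\<close>. Between three zeros of \<open>D / w\<close> there are, by Rolle, two zeros of
  the Wronskian \<open>Q = D' w - D w'\<close>, whereas \<open>Q' = w (D'' + \<kappa> D) < 0\<close>. This also covers accumulation at
  the ends of the interval.\<close>

lemma finite_zeros_strict_supersolution:
  fixes D D' D'' :: "real \<Rightarrow> real"
  assumes \<kappa>: "\<kappa> > 0"
    and D: "\<And>x. x \<in> {0..l} \<Longrightarrow> (D has_real_derivative D' x) (at x within {0..l})"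
    and D': "\<And>x. x \<in> {0..l} \<Longrightarrow> (D' has_real_derivative D'' x) (at x within {0..l})"
    and neg: "\<And>x. x \<in> {0<..<l} \<Longrightarrow> D'' x + \<kappa> * D x < 0"
  shows "finite {x \<in> {0..l}. D x = 0}"
proof (rule ccontr)
  assume inf: "infinite {x \<in> {0..l}. D x = 0}" (is "infinite ?Z")
  obtain m where m: "m islimpt ?Z"
    using Heine_Borel_imp_Bolzano_Weierstrass[OF compact_Icc inf] by blast
  define \<omega> where "\<omega> = sqrt \<kappa>"
  have \<omega>: "\<omega> > 0" "\<omega> * \<omega> = \<kappa>" using \<kappa> by (auto simp: \<omega>_def)
  have "infinite (?Z \<inter> ball m (pi / (2 * \<omega>)))"
    using m \<omega> by (simp add: islimpt_eq_infinite_ball)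
  then obtain a b c where abc: "a < b" "b < c"
    and Z: "a \<in> ?Z" "b \<in> ?Z" "c \<in> ?Z"
    and near: "\<bar>a - m\<bar> < pi / (2 * \<omega>)" "\<bar>c - m\<bar> < pi / (2 * \<omega>)"
    by (rule infinite_three_increasing) (auto simp: dist_real_def abs_minus_commute)
  define w where "w = (\<lambda>x. cos (\<omega> * (x - m)))"
  define w' where "w' = (\<lambda>x. - \<omega> * sin (\<omega> * (x - m)))"
  have w: "(w has_real_derivative w' x) (at x)" for x
    unfolding w_def w'_def by (auto intro!: derivative_eq_intros)
  have w': "(w' has_real_derivative - \<kappa> * w x) (at x)" for x
    unfolding w_def w'_def using \<omega> by (auto intro!: derivative_eq_intros)
  have wpos: "w x > 0" if "x \<in> {a..c}" for x
  proof -
    have "\<bar>x - m\<bar> < pi / (2 * \<omega>)" using near that by auto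
    then have "\<omega> * \<bar>x - m\<bar> < pi / 2" using \<omega> by (simp add: field_simps)
    then have "\<bar>\<omega> * (x - m)\<bar> < pi / 2" using \<omega> by (simp add: abs_mult)
    then show ?thesis unfolding w_def by (intro cos_gt_zero_pi) auto
  qed
  have sub: "{a<..<c} \<subseteq> {0<..<l}" using Z by auto
  have Dat: "(D has_real_derivative D' x) (at x)" "(D' has_real_derivative D'' x) (at x)"
    if "x \<in> {a<..<c}" for x
  proof -
    have "x \<in> {0<..<l}" using sub that by blast
    then show "(D has_real_derivative D' x) (at x)" "(D' has_real_derivative D'' x) (at x)"
      using D[of x] D'[of x] by (auto simp: at_within_Icc_at)
  qed
  define Q where "Q = (\<lambda>x. D' x * w x - D x * w' x)"
  have quot: "((\<lambda>x. D x / w x) has_real_derivative Q x / (w x)\<^sup>2) (at x)"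
    if "x \<in> {a<..<c}" for x
    using Dat[OF that] w[of x] wpos[of x] that unfolding Q_def
    by (auto intro!: derivative_eq_intros simp: field_simps power2_eq_square)
  have Qzero: "\<exists>z. s < z \<and> z < t \<and> Q z = 0"
    if st: "a \<le> s" "s < t" "t \<le> c" "D s = 0" "D t = 0" for s t
  proof -
    have "\<exists>z. s < z \<and> z < t \<and> DERIV (\<lambda>x. D x / w x) z :> 0"
    proof (rule Rolle)
      have "continuous_on {0..l} D" by (rule DERIV_continuous_on[OF D])
      moreover have "{s..t} \<subseteq> {0..l}" using st Z by auto
      moreover have "continuous_on {s..t} w"
        unfolding w_def by (intro continuous_intros)
      moreover have "w x \<noteq> 0" if "x \<in> {s..t}" for x
        using wpos[of x] that st by auto
      ultimately show "continuous_on {s..t} (\<lambda>x. D x / w x)"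
        by (intro continuous_on_divide) (auto intro: continuous_on_subset)
      show "(\<lambda>x. D x / w x) differentiable (at x)" if "s < x" "x < t" for x
        using quot[of x] that st by (auto simp: real_differentiable_def)
    qed (use st in auto)
    then obtain z where z: "s < z" "z < t" "DERIV (\<lambda>x. D x / w x) z :> 0" by blast
    with quot[of z] st have "Q z / (w z)\<^sup>2 = 0" by (auto dest: DERIV_unique)
    with wpos[of z] z st show ?thesis by auto
  qed
  obtain p where p: "a < p" "p < b" "Q p = 0" using Qzero[of a b] abc Z by auto
  obtain q where q: "b < q" "q < c" "Q q = 0" using Qzero[of b c] abc Z by auto
  have "Q p > Q q"
  proof (rule DERIV_neg_imp_decreasing[of p q Q])
    fix x assume "p \<le> x" "x \<le> q"
    then have x: "x \<in> {a<..<c}" using p q by auto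
    have "(Q has_real_derivative w x * (D'' x + \<kappa> * D x)) (at x)"
      unfolding Q_def using Dat[OF x] w[of x] w'[of x]
      by (auto intro!: derivative_eq_intros simp: algebra_simps)
    moreover have "w x * (D'' x + \<kappa> * D x) < 0"
      using wpos[of x] neg[of x] x sub by (auto intro!: mult_pos_neg)
    ultimately show "\<exists>y. (Q has_real_derivative y) (at x) \<and> y < 0" by blast
  qed (use p q in auto)
  with p q show False by simp
qed

section \<open>A coarea inequality on an interval\<close>

text \<open>The inequality needed from the coarea formula: the integral over \<open>t\<close> of the sum of \<open>k\<close> over
  the level set \<open>G = t\<close> is at most \<open>\<integral> k \<bar>G'\<bar>\<close>. The sum need not be measurable in \<open>t\<close>, so it is replaced by
  a measurable majorant \<open>N\<close>, in the manner of Banach's indicatrix: cut the interval into small pieces,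
  count a piece with the weight \<open>min k\<close> if \<open>G\<close> attains the value \<open>t\<close> there, and let the mesh tend to 0.
  The bound for the integral survives the limit by Fatou's lemma. Since \<open>G\<close> and \<open>k\<close> may be singular at the
  ends, the two extreme pieces are left out.\<close>

lemma coarea_inequality:
  fixes G G' k :: "real \<Rightarrow> real"
  assumes l: "0 < l"
    and G: "\<And>x. x \<in> {0<..<l} \<Longrightarrow> (G has_real_derivative G' x) (at x)"
    and G'c: "continuous_on {0<..<l} G'"
    and kc: "continuous_on {0<..<l} k"
    and k0: "\<And>x. x \<in> {0<..<l} \<Longrightarrow> 0 \<le> k x"
  obtains N :: "real \<Rightarrow> ennreal" where "N \<in> borel_measurable borel"
    "\<And>t T. \<lbrakk>finite T; T \<subseteq> {x \<in> {0<..<l}. G x = t}\<rbrakk> \<Longrightarrow> ennreal (\<Sum>x\<in>T. k x) \<le> N t"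
    "(\<integral>\<^sup>+ t. N t \<partial>lborel) \<le> (\<integral>\<^sup>+ x. ennreal (k x * \<bar>G' x\<bar>) * indicator {0<..<l} x \<partial>lborel)"
proof -
  define h where "h = (\<lambda>n::nat. l / real (Suc n))"
  have hpos: "h n > 0" for n using l by (simp add: h_def)
  have hl: "real (Suc n) * h n = l" for n by (simp add: h_def)
  have hlim: "h \<longlonglongrightarrow> 0"
    unfolding h_def by (rule LIMSEQ_Suc) (rule lim_const_over_n)
  define I where "I = (\<lambda>n j. {real j * h n..real (Suc j) * h n})"
  have Isub: "I n j \<subseteq> {0<..<l}" if "j \<in> {1..<n}" for n j
  proof -
    have "0 < real j * h n" using that hpos[of n] by simp
    moreover have "real (Suc j) * h n < real (Suc n) * h n"
      using that hpos[of n] by (intro mult_strict_right_mono) auto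
    ultimately show ?thesis unfolding I_def hl by auto
  qed
  have Ine: "I n j \<noteq> {}" for n j
    unfolding I_def using hpos[of n] by (auto intro!: mult_right_mono)
  have Gc: "continuous_on {0<..<l} G"
    using G by (meson DERIV_isCont continuous_at_imp_continuous_on)
  have "\<exists>y. \<forall>n j. j \<in> {1..<n} \<longrightarrow> y n j \<in> I n j \<and> (\<forall>x\<in>I n j. k (y n j) \<le> k x)"
  proof (rule choice, rule allI, rule choice, rule allI)
    show "\<exists>y. j \<in> {1..<n} \<longrightarrow> y \<in> I n j \<and> (\<forall>x\<in>I n j. k y \<le> k x)" for n j
    proof (cases "j \<in> {1..<n}")
      case True
      have "compact (I n j)" by (simp add: I_def)
      with continuous_attains_inf[OF _ Ine continuous_on_subset[OF kc Isub[OF True]]]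
      show ?thesis by blast
    qed auto
  qed
  then obtain y where y: "\<And>n j. j \<in> {1..<n} \<Longrightarrow> y n j \<in> I n j"
    and ymin: "\<And>n j x. j \<in> {1..<n} \<Longrightarrow> x \<in> I n j \<Longrightarrow> k (y n j) \<le> k x"
    by blast
  define Nn where "Nn = (\<lambda>n t. \<Sum>j\<in>{1..<n}. ennreal (k (y n j)) * indicator (G ` I n j) t)"
  have Gcl: "closed (G ` I n j)" if "j \<in> {1..<n}" for n j
    by (intro compact_imp_closed compact_continuous_image continuous_on_subset[OF Gc Isub[OF that]])
       (auto simp: I_def)
  have Nnm [measurable]: "Nn n \<in> borel_measurable borel" for n
    unfolding Nn_def using Gcl by (intro borel_measurable_sum borel_measurable_times_ennreal) auto
  define N where "N = (\<lambda>t. liminf (\<lambda>n. Nn n t))"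
  define K where "K = (\<lambda>x. indicator {0<..<l} x *\<^sub>R (k x * \<bar>G' x\<bar>))"
  have Km [measurable]: "K \<in> borel_measurable borel"
    unfolding K_def
    by (rule borel_measurable_continuous_on_indicator) (auto intro!: continuous_intros kc G'c)
  define R where "R = (\<integral>\<^sup>+ x. ennreal (K x) \<partial>lborel)"
  \<comment> \<open>the values of \<open>G\<close> on a piece form an interval no longer than the variation of \<open>G\<close> there\<close>
  have piece: "ennreal (k (y n j)) * emeasure lborel (G ` I n j)
      \<le> (\<integral>\<^sup>+ x. ennreal (K x) * indicator {real j * h n..<real (Suc j) * h n} x \<partial>lborel)"
    if j: "j \<in> {1..<n}" for n j
  proof -
    define a b where "a = real j * h n" and "b = real (Suc j) * h n"
    have ab: "{a..b} = I n j" by (simp add: I_def a_def b_def)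
    have sub: "{a..b} \<subseteq> {0<..<l}" unfolding ab by (rule Isub[OF j])
    have "a \<le> b" using hpos[of n] by (auto simp: a_def b_def intro: mult_right_mono)
    then have ab0: "0 < a" "b < l" using sub by auto
    have c: "continuous_on {a..b} G" "continuous_on {a..b} G'" "continuous_on {a..b} k"
      using sub Gc G'c kc by (auto intro: continuous_on_subset)
    have absint: "(\<lambda>x. \<bar>G' x\<bar>) integrable_on {a..b}"
      by (intro integrable_continuous_real continuous_intros c)
    obtain p where p: "p \<in> {a..b}" "\<And>x. x \<in> {a..b} \<Longrightarrow> G p \<le> G x"
      using continuous_attains_inf[OF compact_Icc _ c(1)] Ine[of n j] unfolding ab by blast
    obtain q where q: "q \<in> {a..b}" "\<And>x. x \<in> {a..b} \<Longrightarrow> G x \<le> G q"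
      using continuous_attains_sup[OF compact_Icc _ c(1)] Ine[of n j] unfolding ab by blast
    have var: "\<bar>G t - G s\<bar> \<le> integral {a..b} (\<lambda>x. \<bar>G' x\<bar>)" if "s \<in> {a..b}" "t \<in> {a..b}" "s \<le> t" for s t
    proof -
      have st: "{s..t} \<subseteq> {a..b}" using that by auto
      have "(G' has_integral (G t - G s)) {s..t}"
      proof (rule fundamental_theorem_of_calculus)
        show "(G has_vector_derivative G' x) (at x within {s..t})" if "x \<in> {s..t}" for x
        proof -
          have "x \<in> {0<..<l}" using that st sub by blast
          from G[OF this] show ?thesis
            by (simp add: has_real_derivative_iff_has_vector_derivative has_vector_derivative_at_within)
        qed
      qed fact
      then have "G t - G s = integral {s..t} G'" and "G' integrable_on {s..t}"
        by (auto simp: integral_unique has_integral_integrable)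
      moreover have i: "(\<lambda>x. \<bar>G' x\<bar>) integrable_on {s..t}"
        by (rule integrable_subinterval_real[OF absint st])
      ultimately have "\<bar>G t - G s\<bar> \<le> integral {s..t} (\<lambda>x. \<bar>G' x\<bar>)"
        using integral_norm_bound_integral[of G' "{s..t}" "\<lambda>x. \<bar>G' x\<bar>"] by simp
      also have "\<dots> \<le> integral {a..b} (\<lambda>x. \<bar>G' x\<bar>)"
        by (rule integral_subset_le[OF st i absint]) simp
      finally show ?thesis .
    qed
    have Gpq: "G q - G p \<le> integral {a..b} (\<lambda>x. \<bar>G' x\<bar>)"
      using var[of p q] var[of q p] p(1) q(1) by (cases "p \<le> q") auto
    have "G ` I n j \<subseteq> {G p..G q}" using p q ab by auto
    then have "emeasure lborel (G ` I n j) \<le> emeasure lborel {G p..G q}"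
      by (intro emeasure_mono) auto
    also have "\<dots> = ennreal (G q - G p)" using p q by simp
    also have "\<dots> \<le> ennreal (integral {a..b} (\<lambda>x. \<bar>G' x\<bar>))" by (rule ennreal_leI[OF Gpq])
    finally have "ennreal (k (y n j)) * emeasure lborel (G ` I n j)
        \<le> ennreal (k (y n j)) * ennreal (integral {a..b} (\<lambda>x. \<bar>G' x\<bar>))"
      by (rule mult_left_mono) simp
    also have "\<dots> = ennreal (integral {a..b} (\<lambda>x. k (y n j) * \<bar>G' x\<bar>))"
      using k0[of "y n j"] y[OF j] Isub[OF j]
      by (subst ennreal_mult'[symmetric]) auto
    also have "\<dots> \<le> ennreal (integral {a..b} (\<lambda>x. k x * \<bar>G' x\<bar>))"
      using ymin[OF j] ab
      by (intro ennreal_leI integral_le integrable_continuous_real continuous_intros c mult_right_mono) auto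
    also have "\<dots> = (\<integral>\<^sup>+ x. ennreal (indicator {a..b} x * (k x * \<bar>G' x\<bar>)) \<partial>lborel)"
      using k0 sub
      by (intro nn_integral_has_integral_lebesgue[symmetric] integrable_integral
            integrable_continuous_real continuous_intros c) auto
    also have "\<dots> = (\<integral>\<^sup>+ x. ennreal (K x) * indicator {a..<b} x \<partial>lborel)"
    proof (rule nn_integral_cong_AE)
      show "AE x in lborel. ennreal (indicator {a..b} x * (k x * \<bar>G' x\<bar>)) = ennreal (K x) * indicator {a..<b} x"
        using AE_lborel_singleton[of b]
        by (rule AE_mp) (intro AE_I2, use ab0 in \<open>auto simp: K_def split: split_indicator\<close>)
    qed
    finally show ?thesis unfolding a_def b_def .
  qed
  have Nint: "(\<integral>\<^sup>+ t. Nn n t \<partial>lborel) \<le> R" for n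
  proof -
    define J where "J = (\<lambda>j. {real j * h n..<real (Suc j) * h n})"
    have "disjoint_family_on J {1..<n}"
      unfolding disjoint_family_on_def
    proof (intro ballI impI)
      fix i j :: nat assume "i \<noteq> j"
      have le: "i \<le> j" if "real i * h n \<le> x" "x < real (Suc j) * h n" for i j x
      proof -
        have "real i * h n < real (Suc j) * h n" using that by linarith
        then show ?thesis using hpos[of n] by simp
      qed
      show "J i \<inter> J j = {}"
      proof (rule ccontr)
        assume "J i \<inter> J j \<noteq> {}"
        then obtain x where "x \<in> J i" "x \<in> J j" by blast
        then have "i \<le> j" "j \<le> i" using le[of i x j] le[of j x i] unfolding J_def by auto
        with \<open>i \<noteq> j\<close> show False by simp
      qed
    qed
    then have ind: "(\<Sum>j\<in>{1..<n}. indicator (J j) x) = (indicator (\<Union>j\<in>{1..<n}. J j) x :: ennreal)" for x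
      by (subst indicator_UN_disjoint) auto
    have "(\<integral>\<^sup>+ t. Nn n t \<partial>lborel) = (\<Sum>j\<in>{1..<n}. ennreal (k (y n j)) * emeasure lborel (G ` I n j))"
      unfolding Nn_def using Gcl
      by (subst nn_integral_sum) (auto simp: nn_integral_cmult intro!: sum.cong borel_measurable_times_ennreal)
    also have "\<dots> \<le> (\<Sum>j\<in>{1..<n}. \<integral>\<^sup>+ x. ennreal (K x) * indicator (J j) x \<partial>lborel)"
      unfolding J_def by (rule sum_mono) (rule piece)
    also have "\<dots> = (\<integral>\<^sup>+ x. (\<Sum>j\<in>{1..<n}. ennreal (K x) * indicator (J j) x) \<partial>lborel)"
      by (subst nn_integral_sum) (auto simp: J_def)
    also have "\<dots> \<le> R"
      unfolding R_def sum_distrib_left[symmetric] ind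
      by (intro nn_integral_mono) (auto split: split_indicator)
    finally show ?thesis .
  qed
  have lower: "ennreal (\<Sum>x\<in>T. k x) \<le> N t"
    if T: "finite T" "T \<subseteq> {x \<in> {0<..<l}. G x = t}" for t T
  proof -
    define i where "i = (\<lambda>n x. nat \<lfloor>x / h n\<rfloor>)"
    have iI: "x \<in> I n (i n x)" if "x > 0" for n x
    proof -
      have "real (i n x) \<le> x / h n" "x / h n < real (Suc (i n x))"
        using that hpos[of n] unfolding i_def by (auto simp: of_nat_nat) linarith+
      then show ?thesis using hpos[of n] by (auto simp: I_def field_simps)
    qed
    have iev: "\<forall>\<^sub>F n in sequentially. i n x \<in> {1..<n}" if "x \<in> {0<..<l}" for x
    proof -
      have "\<forall>\<^sub>F n in sequentially. h n < min x (l - x)"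
        using order_tendstoD(2)[OF hlim, of "min x (l - x)"] that by auto
      then show ?thesis
      proof eventually_elim
        case (elim n)
        have b: "real (i n x) * h n \<le> x" "x \<le> real (Suc (i n x)) * h n"
          using iI[of x n] that by (auto simp: I_def)
        have "real (Suc (i n x)) * h n < l" using b elim by (simp add: algebra_simps)
        then have "real (Suc (i n x)) * h n < real (Suc n) * h n" unfolding hl .
        then have "i n x < n" using hpos[of n] by simp
        moreover have "i n x \<noteq> 0" using b elim by (intro notI) simp
        ultimately show ?case by simp
      qed
    qed
    have yI: "\<bar>y n (i n x) - x\<bar> \<le> h n" if "x > 0" "i n x \<in> {1..<n}" for n x
      using iI[OF that(1), of n] y[OF that(2)] by (auto simp: I_def algebra_simps)
    have ev1: "\<forall>\<^sub>F n in sequentially. \<forall>x\<in>T. i n x \<in> {1..<n}"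
      using T iev by (auto intro!: eventually_ball_finite)
    \<comment> \<open>once the mesh is finer than the gaps of \<open>T\<close>, its points lie in different pieces\<close>
    have ev2: "\<forall>\<^sub>F n in sequentially. \<forall>x\<in>T. \<forall>x'\<in>T. x \<noteq> x' \<longrightarrow> h n < \<bar>x - x'\<bar>"
    proof (intro eventually_ball_finite ballI T(1))
      fix x x' assume "x \<in> T" "x' \<in> T"
      show "\<forall>\<^sub>F n in sequentially. x \<noteq> x' \<longrightarrow> h n < \<bar>x - x'\<bar>"
        using order_tendstoD(2)[OF hlim, of "\<bar>x - x'\<bar>"] by (cases "x = x'") auto
    qed
    have "(\<lambda>n. k (y n (i n x))) \<longlonglongrightarrow> k x" if x: "x \<in> T" for x
    proof -
      have x0: "x \<in> {0<..<l}" using x T by auto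
      have "(\<lambda>n. y n (i n x) - x) \<longlonglongrightarrow> 0"
        using yI x0 by (intro Lim_null_comparison[OF _ hlim] eventually_mono[OF iev[OF x0]]) auto
      then have "(\<lambda>n. y n (i n x)) \<longlonglongrightarrow> x" by (simp add: LIM_zero_iff)
      moreover have "isCont k x" using kc x0 by (simp add: continuous_on_eq_continuous_at)
      ultimately show ?thesis using isCont_tendsto_compose by blast
    qed
    then have "(\<lambda>n. \<Sum>x\<in>T. k (y n (i n x))) \<longlonglongrightarrow> (\<Sum>x\<in>T. k x)"
      by (rule tendsto_sum)
    then have lim: "(\<lambda>n. ennreal (\<Sum>x\<in>T. k (y n (i n x)))) \<longlonglongrightarrow> ennreal (\<Sum>x\<in>T. k x)"
      by (rule tendsto_ennrealI)
    have "\<forall>\<^sub>F n in sequentially. ennreal (\<Sum>x\<in>T. k (y n (i n x))) \<le> Nn n t"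
      using ev1 ev2
    proof eventually_elim
      case (elim n)
      have inj: "inj_on (i n) T"
      proof (rule inj_onI, rule ccontr)
        fix x x' assume xx: "x \<in> T" "x' \<in> T" "i n x = i n x'" "x \<noteq> x'"
        have "x \<in> I n (i n x)" "x' \<in> I n (i n x)"
          using iI[of x n] iI[of x' n] xx T by auto
        then have "\<bar>x - x'\<bar> \<le> h n" by (auto simp: I_def algebra_simps)
        with elim xx show False by fastforce
      qed
      have nn: "0 \<le> k (y n j)" if "j \<in> {1..<n}" for j
        using k0 y[OF that] Isub[OF that] by blast
      have "ennreal (\<Sum>x\<in>T. k (y n (i n x))) = (\<Sum>x\<in>T. ennreal (k (y n (i n x))))"
        using nn elim by (subst sum_ennreal) auto
      also have "\<dots> = (\<Sum>x\<in>T. ennreal (k (y n (i n x))) * indicator (G ` I n (i n x)) t)"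
      proof (rule sum.cong)
        fix x assume "x \<in> T"
        then have "t \<in> G ` I n (i n x)" using T iI[of x n] by auto
        then show "ennreal (k (y n (i n x))) = ennreal (k (y n (i n x))) * indicator (G ` I n (i n x)) t"
          by simp
      qed simp
      also have "\<dots> = (\<Sum>j\<in>i n ` T. ennreal (k (y n j)) * indicator (G ` I n j) t)"
        by (simp add: sum.reindex[OF inj])
      also have "\<dots> \<le> Nn n t"
        unfolding Nn_def by (rule sum_mono2) (use elim in auto)
      finally show ?case .
    qed
    then have "Liminf sequentially (\<lambda>n. ennreal (\<Sum>x\<in>T. k (y n (i n x)))) \<le> N t"
      unfolding N_def by (rule Liminf_mono)
    then show ?thesis using lim_imp_Liminf[OF _ lim] by simp
  qed
  show thesis
  proof (rule that[of N])
    show "N \<in> borel_measurable borel" unfolding N_def by measurable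
    have "(\<integral>\<^sup>+ t. N t \<partial>lborel) \<le> liminf (\<lambda>n. \<integral>\<^sup>+ t. Nn n t \<partial>lborel)"
      unfolding N_def by (rule nn_integral_liminf) simp
    also have "\<dots> \<le> R"
      using Liminf_mono[of "\<lambda>n. \<integral>\<^sup>+ t. Nn n t \<partial>lborel" "\<lambda>_. R" sequentially] Nint
      by (simp add: Liminf_const)
    also have "R = (\<integral>\<^sup>+ x. ennreal (k x * \<bar>G' x\<bar>) * indicator {0<..<l} x \<partial>lborel)"
      unfolding R_def K_def by (intro nn_integral_cong) (auto split: split_indicator)
    finally show "(\<integral>\<^sup>+ t. N t \<partial>lborel) \<le> (\<integral>\<^sup>+ x. ennreal (k x * \<bar>G' x\<bar>) * indicator {0<..<l} x \<partial>lborel)" .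
  qed (use lower in auto)
qed

section \<open>Functions on a metric graph\<close>

lemma has_L2_derivative_cong:
  assumes "has_L2_derivative l f g" and eq: "\<And>x. x \<in> {0..l} \<Longrightarrow> f x = f' x"
  shows "has_L2_derivative l f' g"
proof -
  have "f' x = f' 0 + (\<integral>t. g t \<partial>lebesgue_on {0..x})" if x: "x \<in> {0..l}" for x
  proof -
    have "f x = f 0 + (\<integral>t. g t \<partial>lebesgue_on {0..x})"
      using assms(1) x unfolding has_L2_derivative_def by blast
    moreover have "f 0 = f' 0" using x by (intro eq) auto
    ultimately show ?thesis using eq[OF x] by simp
  qed
  then show ?thesis using assms(1) unfolding has_L2_derivative_def by blast
qed

lemma has_L2_derivative_zero: "has_L2_derivative l (\<lambda>x. 0) (\<lambda>x. 0)"
  by (auto simp: has_L2_derivative_def square_integrable_on_def)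

context
  fixes \<Gamma> :: "('v, 'e) metric_graph"
  assumes \<Gamma>: "is_metric_graph \<Gamma>"
begin

lemma finite_edges: "finite (edges \<Gamma>)"
  using \<Gamma> unfolding is_metric_graph_def fin_digraph_def fin_digraph_axioms_def by blast

lemma finite_vertices: "finite (vertices \<Gamma>)"
  using \<Gamma> unfolding is_metric_graph_def fin_digraph_def fin_digraph_axioms_def by blast

lemma len_pos: "e \<in> edges \<Gamma> \<Longrightarrow> 0 < len \<Gamma> e"
  using \<Gamma> unfolding is_metric_graph_def by blast

lemma edge_ends:
  assumes "e \<in> edges \<Gamma>"
  shows "tail (skeleton \<Gamma>) e \<in> vertices \<Gamma>" "head (skeleton \<Gamma>) e \<in> vertices \<Gamma>"
proof -
  have "wf_digraph (skeleton \<Gamma>)"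
    using \<Gamma> unfolding is_metric_graph_def fin_digraph_def by blast
  then show "tail (skeleton \<Gamma>) e \<in> vertices \<Gamma>" "head (skeleton \<Gamma>) e \<in> vertices \<Gamma>"
    using assms by (auto simp: wf_digraph_def)
qed

lemma edge_point_in_points:
  assumes "e \<in> edges \<Gamma>" "x \<in> {0..len \<Gamma> e}"
  shows "edge_point \<Gamma> e x \<in> points \<Gamma>"
  using assms edge_ends[OF assms(1)] by (auto simp: edge_point_def points_def)

lemma topspace_graph: "topspace (graph_topology \<Gamma>) = points \<Gamma>"
proof
  show "topspace (graph_topology \<Gamma>) \<subseteq> points \<Gamma>"
    using openin_topspace[of "graph_topology \<Gamma>"] unfolding openin_graph_topology by blast
  have "openin (graph_topology \<Gamma>) (points \<Gamma>)"
    unfolding openin_graph_topology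
  proof (intro conjI ballI)
    fix e assume e: "e \<in> edges \<Gamma>"
    have "{x \<in> {0..len \<Gamma> e}. edge_point \<Gamma> e x \<in> points \<Gamma>} = {0..len \<Gamma> e}"
      using edge_point_in_points[OF e] by blast
    then show "openin (top_of_set {0..len \<Gamma> e}) {x \<in> {0..len \<Gamma> e}. edge_point \<Gamma> e x \<in> points \<Gamma>}"
      by simp
  qed simp
  then show "points \<Gamma> \<subseteq> topspace (graph_topology \<Gamma>)" by (rule openin_subset)
qed

lemma continuous_map_graph_iff:
  fixes u :: "('v, 'e) point \<Rightarrow> real"
  shows "continuous_map (graph_topology \<Gamma>) euclideanreal u \<longleftrightarrow>
    (\<forall>e\<in>edges \<Gamma>. continuous_on {0..len \<Gamma> e} (u \<circ> edge_point \<Gamma> e))"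
proof -
  have pre: "{x \<in> {0..len \<Gamma> e}. edge_point \<Gamma> e x \<in> {p \<in> points \<Gamma>. u p \<in> U}}
      = {x \<in> {0..len \<Gamma> e}. (u \<circ> edge_point \<Gamma> e) x \<in> U}" if "e \<in> edges \<Gamma>" for e U
    using edge_point_in_points[OF that] by auto
  have "continuous_map (graph_topology \<Gamma>) euclideanreal u \<longleftrightarrow>
    (\<forall>U. open U \<longrightarrow> (\<forall>e\<in>edges \<Gamma>. openin (top_of_set {0..len \<Gamma> e})
      {x \<in> {0..len \<Gamma> e}. edge_point \<Gamma> e x \<in> {p \<in> points \<Gamma>. u p \<in> U}}))"
    unfolding continuous_map_def topspace_graph openin_graph_topology by auto
  also have "\<dots> \<longleftrightarrow> (\<forall>U. open U \<longrightarrow> (\<forall>e\<in>edges \<Gamma>. openin (top_of_set {0..len \<Gamma> e})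
      {x \<in> {0..len \<Gamma> e}. (u \<circ> edge_point \<Gamma> e) x \<in> U}))"
    using pre by (metis (no_types, lifting))
  also have "\<dots> \<longleftrightarrow> (\<forall>e\<in>edges \<Gamma>. continuous_map (top_of_set {0..len \<Gamma> e}) euclideanreal
      (u \<circ> edge_point \<Gamma> e))"
    unfolding continuous_map_def by auto
  finally show ?thesis by (simp add: continuous_map_iff_continuous)
qed

text \<open>The form may be computed with any \<open>L\<^sup>2\<close> derivatives, as they are unique almost everywhere.\<close>

lemma energy_form_eq:
  assumes u: "\<And>e. e \<in> edges \<Gamma> \<Longrightarrow> has_L2_derivative (len \<Gamma> e) (u \<circ> edge_point \<Gamma> e) (g e)"
    and v: "\<And>e. e \<in> edges \<Gamma> \<Longrightarrow> has_L2_derivative (len \<Gamma> e) (v \<circ> edge_point \<Gamma> e) (h e)"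
  shows "energy_form \<Gamma> u v = (\<Sum>e\<in>edges \<Gamma>. \<integral>x. g e x * h e x \<partial>lebesgue_on {0..len \<Gamma> e})"
  unfolding energy_form_def
proof (rule sum.cong)
  fix e assume e: "e \<in> edges \<Gamma>"
  let ?M = "lebesgue_on {0..len \<Gamma> e}"
  have u': "has_L2_derivative (len \<Gamma> e) (u \<circ> edge_point \<Gamma> e) (edge_derivative \<Gamma> u e)"
    unfolding edge_derivative_def by (rule someI[of _ "g e"]) (rule u[OF e])
  have v': "has_L2_derivative (len \<Gamma> e) (v \<circ> edge_point \<Gamma> e) (edge_derivative \<Gamma> v e)"
    unfolding edge_derivative_def by (rule someI[of _ "h e"]) (rule v[OF e])
  have [measurable]: "edge_derivative \<Gamma> u e \<in> borel_measurable ?M"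
    "edge_derivative \<Gamma> v e \<in> borel_measurable ?M" "g e \<in> borel_measurable ?M" "h e \<in> borel_measurable ?M"
    using u' v' u[OF e] v[OF e] by (blast intro: borel_measurable_integrable L2_derivative_integrable)+
  have "AE x in ?M. edge_derivative \<Gamma> u e x = g e x" by (rule L2_derivative_unique[OF u' u[OF e]])
  moreover have "AE x in ?M. edge_derivative \<Gamma> v e x = h e x" by (rule L2_derivative_unique[OF v' v[OF e]])
  ultimately have "AE x in ?M. edge_derivative \<Gamma> u e x * edge_derivative \<Gamma> v e x = g e x * h e x"
    by eventually_elim simp
  then show "(\<integral>x. edge_derivative \<Gamma> u e x * edge_derivative \<Gamma> v e x \<partial>?M) = (\<integral>x. g e x * h e x \<partial>?M)"
    by (intro integral_cong_AE) auto
qed simp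

lemma form_domainI:
  assumes "\<And>e. e \<in> edges \<Gamma> \<Longrightarrow> has_L2_derivative (len \<Gamma> e) (v \<circ> edge_point \<Gamma> e) (h e)"
    and "\<And>p. p \<notin> points \<Gamma> \<Longrightarrow> v p = 0"
    and "\<And>w. w \<in> dirichlet \<Gamma> \<Longrightarrow> v (Vertex w) = 0"
  shows "v \<in> form_domain \<Gamma>"
proof -
  have "continuous_on {0..len \<Gamma> e} (v \<circ> edge_point \<Gamma> e)" if "e \<in> edges \<Gamma>" for e
    by (rule L2_derivative_continuous[OF assms(1)[OF that]])
  then have "continuous_map (graph_topology \<Gamma>) euclideanreal v"
    unfolding continuous_map_graph_iff by blast
  moreover have "\<forall>e\<in>edges \<Gamma>. \<exists>g. has_L2_derivative (len \<Gamma> e) (v \<circ> edge_point \<Gamma> e) g"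
    using assms(1) by blast
  ultimately show ?thesis
    using assms(2,3) unfolding form_domain_def graph_H1_def by simp
qed

lemma eigenfunction_domain: "u \<in> eigenspace \<Gamma> \<mu> \<Longrightarrow> u \<in> form_domain \<Gamma>"
  unfolding eigenspace_def neg_laplacian_def by blast

lemma eigenfunction_weak:
  assumes u: "u \<in> eigenspace \<Gamma> \<mu>"
    and du: "\<And>e. e \<in> edges \<Gamma> \<Longrightarrow> has_L2_derivative (len \<Gamma> e) (u \<circ> edge_point \<Gamma> e) (g e)"
    and v: "v \<in> form_domain \<Gamma>"
    and dv: "\<And>e. e \<in> edges \<Gamma> \<Longrightarrow> has_L2_derivative (len \<Gamma> e) (v \<circ> edge_point \<Gamma> e) (h e)"
  shows "(\<Sum>e\<in>edges \<Gamma>. \<integral>x. g e x * h e x \<partial>lebesgue_on {0..len \<Gamma> e})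
    = \<mu> * (\<Sum>e\<in>edges \<Gamma>. \<integral>x. u (edge_point \<Gamma> e x) * v (edge_point \<Gamma> e x) \<partial>lebesgue_on {0..len \<Gamma> e})"
proof -
  have "(\<Sum>e\<in>edges \<Gamma>. \<integral>x. g e x * h e x \<partial>lebesgue_on {0..len \<Gamma> e}) = energy_form \<Gamma> u v"
    by (rule energy_form_eq[OF du dv, symmetric])
  also have "\<dots> = L2_inner \<Gamma> (\<lambda>p. \<mu> * u p) v"
    using u v unfolding eigenspace_def neg_laplacian_def by blast
  finally show ?thesis
    unfolding L2_inner_def by (simp add: sum_distrib_left mult.assoc)
qed

text \<open>A function on one edge that vanishes at both ends extends by zero to the graph.\<close>

lemma extend_by_zero:
  assumes e: "e \<in> edges \<Gamma>" and d: "has_L2_derivative (len \<Gamma> e) d h"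
    and ends: "d 0 = 0" "d (len \<Gamma> e) = 0"
  obtains v where "v \<in> form_domain \<Gamma>"
    "\<And>x. x \<in> {0..len \<Gamma> e} \<Longrightarrow> v (edge_point \<Gamma> e x) = d x"
    "\<And>e' x. \<lbrakk>e' \<noteq> e; x \<in> {0..len \<Gamma> e'}\<rbrakk> \<Longrightarrow> v (edge_point \<Gamma> e' x) = 0"
proof -
  define v where "v = (\<lambda>p :: ('v, 'e) point. case p of Vertex w \<Rightarrow> 0
    | Inner e' x \<Rightarrow> if e' = e \<and> 0 < x \<and> x < len \<Gamma> e then d x else 0)"
  have on: "v (edge_point \<Gamma> e x) = d x" if "x \<in> {0..len \<Gamma> e}" for x
    using that ends by (auto simp: v_def edge_point_def)
  have off: "v (edge_point \<Gamma> e' x) = 0" if "e' \<noteq> e" for e' x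
    using that by (auto simp: v_def edge_point_def)
  have "v \<in> form_domain \<Gamma>"
  proof (rule form_domainI)
    show "has_L2_derivative (len \<Gamma> e') (v \<circ> edge_point \<Gamma> e') (if e' = e then h else (\<lambda>x. 0))" for e'
    proof (cases "e' = e")
      case True
      then show ?thesis using has_L2_derivative_cong[OF d] on by simp
    next
      case False
      then show ?thesis using has_L2_derivative_cong[OF has_L2_derivative_zero] off by simp
    qed
    show "v p = 0" if "p \<notin> points \<Gamma>" for p
      using that e by (auto simp: v_def points_def split: point.split)
  qed (simp add: v_def)
  with on off show thesis by (intro that[of v]) auto
qed

lemma eigenfunction_classical:
  assumes u: "u \<in> eigenspace \<Gamma> \<mu>" and e: "e \<in> edges \<Gamma>"
  obtains u' where
    "\<And>x. x \<in> {0..len \<Gamma> e} \<Longrightarrow> ((u \<circ> edge_point \<Gamma> e) has_real_derivative u' x) (at x within {0..len \<Gamma> e})"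
    "\<And>x. x \<in> {0..len \<Gamma> e} \<Longrightarrow> (u' has_real_derivative - \<mu> * (u \<circ> edge_point \<Gamma> e) x) (at x within {0..len \<Gamma> e})"
proof -
  have "\<forall>e\<in>edges \<Gamma>. \<exists>g. has_L2_derivative (len \<Gamma> e) (u \<circ> edge_point \<Gamma> e) g"
    using eigenfunction_domain[OF u] unfolding form_domain_def graph_H1_def by blast
  then obtain g where g: "\<And>e. e \<in> edges \<Gamma> \<Longrightarrow> has_L2_derivative (len \<Gamma> e) (u \<circ> edge_point \<Gamma> e) (g e)"
    by metis
  have weak: "(\<integral>x. g e x * h x \<partial>lebesgue_on {0..len \<Gamma> e})
      = \<mu> * (\<integral>x. (u \<circ> edge_point \<Gamma> e) x * d x \<partial>lebesgue_on {0..len \<Gamma> e})"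
    if d: "has_L2_derivative (len \<Gamma> e) d h" and ends: "d 0 = 0" "d (len \<Gamma> e) = 0" for d h
  proof -
    obtain v where v: "v \<in> form_domain \<Gamma>"
      and on: "\<And>x. x \<in> {0..len \<Gamma> e} \<Longrightarrow> v (edge_point \<Gamma> e x) = d x"
      and off: "\<And>e' x. \<lbrakk>e' \<noteq> e; x \<in> {0..len \<Gamma> e'}\<rbrakk> \<Longrightarrow> v (edge_point \<Gamma> e' x) = 0"
      by (rule extend_by_zero[OF e d ends]) blast
    define H where "H = (\<lambda>e'. if e' = e then h else (\<lambda>x. 0))"
    have dv: "has_L2_derivative (len \<Gamma> e') (v \<circ> edge_point \<Gamma> e') (H e')" for e'
    proof (cases "e' = e")
      case True
      then show ?thesis using has_L2_derivative_cong[OF d] on by (simp add: H_def)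
    next
      case False
      then show ?thesis using has_L2_derivative_cong[OF has_L2_derivative_zero] off by (simp add: H_def)
    qed
    have "(\<Sum>e'\<in>edges \<Gamma>. \<integral>x. g e' x * H e' x \<partial>lebesgue_on {0..len \<Gamma> e'})
      = \<mu> * (\<Sum>e'\<in>edges \<Gamma>. \<integral>x. u (edge_point \<Gamma> e' x) * v (edge_point \<Gamma> e' x) \<partial>lebesgue_on {0..len \<Gamma> e'})"
      by (rule eigenfunction_weak[OF u g v dv])
    also have "(\<Sum>e'\<in>edges \<Gamma>. \<integral>x. g e' x * H e' x \<partial>lebesgue_on {0..len \<Gamma> e'})
        = (\<Sum>e'\<in>{e}. \<integral>x. g e' x * H e' x \<partial>lebesgue_on {0..len \<Gamma> e'})"
      by (rule sum.mono_neutral_right) (use e finite_edges in \<open>auto simp: H_def\<close>)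
    also have "\<dots> = (\<integral>x. g e x * h x \<partial>lebesgue_on {0..len \<Gamma> e})" by (simp add: H_def)
    also have "(\<Sum>e'\<in>edges \<Gamma>. \<integral>x. u (edge_point \<Gamma> e' x) * v (edge_point \<Gamma> e' x) \<partial>lebesgue_on {0..len \<Gamma> e'})
       = (\<Sum>e'\<in>{e}. \<integral>x. u (edge_point \<Gamma> e' x) * v (edge_point \<Gamma> e' x) \<partial>lebesgue_on {0..len \<Gamma> e'})"
    proof (rule sum.mono_neutral_right)
      show "\<forall>e'\<in>edges \<Gamma> - {e}. (\<integral>x. u (edge_point \<Gamma> e' x) * v (edge_point \<Gamma> e' x) \<partial>lebesgue_on {0..len \<Gamma> e'}) = 0"
        using off by (intro ballI integral_eq_zero_AE AE_I2) simp
    qed (use e finite_edges in auto)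
    also have "\<dots> = (\<integral>x. (u \<circ> edge_point \<Gamma> e) x * d x \<partial>lebesgue_on {0..len \<Gamma> e})"
      using on by (auto intro!: Bochner_Integration.integral_cong)
    finally show ?thesis .
  qed
  show thesis
    by (rule weak_solution_classical[OF g[OF e] len_pos[OF e] weak], assumption, assumption, assumption)
       (rule that)
qed

end

section \<open>Picone's inequality and the energy bound\<close>

lemma has_real_derivative_max0_square:
  "((\<lambda>y::real. (max 0 y)\<^sup>2) has_real_derivative 2 * max 0 y) (at y)"
proof -
  consider "y > 0" | "y < 0" | "y = 0" by linarith
  then show ?thesis
  proof cases
    case 1
    have "((\<lambda>y::real. y\<^sup>2) has_real_derivative 2 * max 0 y) (at y)"
      using 1 by (auto intro!: derivative_eq_intros)
    then show ?thesis
      by (rule has_field_derivative_transform_within_open[of _ _ _ "{0<..}"]) (use 1 in auto)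
  next
    case 2
    have "((\<lambda>y::real. 0) has_real_derivative 2 * max 0 y) (at y)"
      using 2 by (auto intro!: derivative_eq_intros)
    then show ?thesis
      by (rule has_field_derivative_transform_within_open[of _ _ _ "{..<0}"]) (use 2 in auto)
  next
    case 3
    have "(\<lambda>h::real. ((max 0 h)\<^sup>2) / h) \<midarrow>0\<rightarrow> 0"
    proof (rule Lim_null_comparison)
      show "\<forall>\<^sub>F h::real in at 0. norm (((max 0 h)\<^sup>2) / h) \<le> \<bar>h\<bar>"
        by (intro always_eventually) (auto simp: max_def power2_eq_square)
      show "(\<lambda>h::real. \<bar>h\<bar>) \<midarrow>0\<rightarrow> 0" by (intro tendsto_eq_intros) auto
    qed
    then show ?thesis using 3 by (simp add: DERIV_def)
  qed
qed

text \<open>A \<open>C\<^sup>1\<close> approximation of the positive part, which keeps all test functions below \<open>C\<^sup>1\<close> on the edges,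
  and its derivative. For \<open>\<epsilon> > 0\<close> it vanishes on the negative half-line, and its slope lies in \<open>[0, 1]\<close>.\<close>

definition smooth_pos :: "real \<Rightarrow> real \<Rightarrow> real" where
  "smooth_pos \<epsilon> y = sqrt ((max 0 y)\<^sup>2 + \<epsilon>\<^sup>2) - \<epsilon>"

definition smooth_pos' :: "real \<Rightarrow> real \<Rightarrow> real" where
  "smooth_pos' \<epsilon> y = max 0 y / sqrt ((max 0 y)\<^sup>2 + \<epsilon>\<^sup>2)"

lemma smooth_pos_deriv:
  assumes "\<epsilon> > 0"
  shows "(smooth_pos \<epsilon> has_real_derivative smooth_pos' \<epsilon> y) (at y)"
proof -
  have pos: "(max 0 y)\<^sup>2 + \<epsilon>\<^sup>2 > 0" using assms by (simp add: add_nonneg_pos)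
  have "((\<lambda>y. (max 0 y)\<^sup>2 + \<epsilon>\<^sup>2) has_real_derivative 2 * max 0 y + 0) (at y)"
    by (intro DERIV_add has_real_derivative_max0_square DERIV_const)
  from DERIV_diff[OF DERIV_chain2[OF DERIV_real_sqrt[OF pos] this] DERIV_const[of \<epsilon>]]
  show ?thesis
    unfolding smooth_pos_def[abs_def] smooth_pos'_def by (simp add: field_simps)
qed

lemma smooth_pos_bounds:
  assumes "\<epsilon> > 0"
  shows "0 \<le> smooth_pos \<epsilon> y" "smooth_pos \<epsilon> y \<le> max 0 y"
    "0 \<le> smooth_pos' \<epsilon> y" "smooth_pos' \<epsilon> y \<le> 1"
proof -
  define m where "m = max 0 y"
  have m: "m \<ge> 0" by (simp add: m_def)
  have s: "sqrt (m\<^sup>2 + \<epsilon>\<^sup>2) \<ge> \<epsilon>" "sqrt (m\<^sup>2 + \<epsilon>\<^sup>2) \<ge> m"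
    "sqrt (m\<^sup>2 + \<epsilon>\<^sup>2) \<le> m + \<epsilon>"
    by (rule real_sqrt_sum_squares_ge2, rule real_sqrt_sum_squares_ge1,
        rule sqrt_sum_squares_le_sum[OF m less_imp_le[OF assms]])
  show "0 \<le> smooth_pos \<epsilon> y" "smooth_pos \<epsilon> y \<le> max 0 y"
    using s by (auto simp: smooth_pos_def m_def[symmetric])
  show "0 \<le> smooth_pos' \<epsilon> y" "smooth_pos' \<epsilon> y \<le> 1"
  proof -
    have p: "sqrt (m\<^sup>2 + \<epsilon>\<^sup>2) > 0" using s(1) assms by linarith
    show "0 \<le> smooth_pos' \<epsilon> y"
      unfolding smooth_pos'_def m_def[symmetric] using m p by (intro divide_nonneg_pos)
    show "smooth_pos' \<epsilon> y \<le> 1"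
      unfolding smooth_pos'_def m_def[symmetric] divide_le_eq_1_pos[OF p] by (rule s(2))
  qed
qed

lemma continuous_on_smooth_pos':
  assumes "\<epsilon> > 0" "continuous_on A f"
  shows "continuous_on A (\<lambda>x. smooth_pos' \<epsilon> (f x))"
proof -
  have "sqrt ((max 0 y)\<^sup>2 + \<epsilon>\<^sup>2) \<noteq> 0" for y :: real
    using assms(1) by (simp add: sum_power2_eq_zero_iff)
  then show ?thesis unfolding smooth_pos'_def using assms(2) by (intro continuous_intros) auto
qed

lemma smooth_pos_tendsto:
  assumes "(\<lambda>n::nat. \<epsilon> n) \<longlonglongrightarrow> 0"
  shows "(\<lambda>n. smooth_pos (\<epsilon> n) y) \<longlonglongrightarrow> max 0 y"
    and "y > 0 \<Longrightarrow> (\<lambda>n. smooth_pos' (\<epsilon> n) y) \<longlonglongrightarrow> 1"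
  unfolding smooth_pos_def smooth_pos'_def using assms
  by (auto intro!: tendsto_eq_intros)

text \<open>Picone's identity for the test functions \<open>r(\<psi>)\<close> and \<open>r(\<psi>)\<^sup>2 / c\<close>, where \<open>c = \<phi> + \<epsilon>\<close>: it becomes an
  inequality because the slope \<open>r'\<close> is at most 1. Here \<open>r\<close> and \<open>r'\<close> are the values at one point.\<close>

lemma picone_pointwise:
  fixes r r' \<psi>' \<phi>' c :: real
  assumes "c > 0" "0 \<le> r'" "r' \<le> 1"
  shows "(r' * \<psi>' - r * \<phi>' / c)\<^sup>2
    \<le> \<psi>' * (r' * \<psi>') - \<phi>' * (2 * r * (r' * \<psi>') / c - r\<^sup>2 * \<phi>' / c\<^sup>2)"
proof -
  have "r' * r' * \<psi>'\<^sup>2 \<le> r' * \<psi>'\<^sup>2"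
    using assms by (intro mult_right_mono mult_left_le) auto
  moreover have "(r' * \<psi>' - r * \<phi>' / c)\<^sup>2
     = r' * r' * \<psi>'\<^sup>2 - \<phi>' * (2 * r * (r' * \<psi>') / c - r\<^sup>2 * \<phi>' / c\<^sup>2)"
    using assms by (simp add: power2_eq_square field_simps)
  ultimately show ?thesis by (simp add: power2_eq_square algebra_simps)
qed

lemma borel_measurable_ennreal_indicator:
  fixes f :: "real \<Rightarrow> real"
  assumes "A \<in> sets borel" "continuous_on A f"
  shows "(\<lambda>x. ennreal (f x) * indicator A x) \<in> borel_measurable borel"
proof -
  have "(\<lambda>x. indicator A x *\<^sub>R f x) \<in> borel_measurable borel"
    by (rule borel_measurable_continuous_on_indicator[OF assms])
  then have "(\<lambda>x. ennreal (indicator A x *\<^sub>R f x)) \<in> borel_measurable borel"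
    by measurable
  also have "(\<lambda>x. ennreal (indicator A x *\<^sub>R f x)) = (\<lambda>x. ennreal (f x) * indicator A x)"
    by (auto split: split_indicator)
  finally show ?thesis .
qed

lemma nn_integral_eq_lebesgue_on:
  fixes f :: "real \<Rightarrow> real"
  assumes "continuous_on {a..b} f" "\<And>x. x \<in> {a..b} \<Longrightarrow> 0 \<le> f x"
  shows "(\<integral>\<^sup>+ x. ennreal (f x) * indicator {a..b} x \<partial>lborel) = ennreal (\<integral>x. f x \<partial>lebesgue_on {a..b})"
proof -
  have i: "integrable (lebesgue_on {a..b}) f" by (rule integrable_continuous_lebesgue_on[OF assms(1)])
  have "(\<integral>\<^sup>+ x. ennreal (f x) * indicator {a..b} x \<partial>lborel)
      = (\<integral>\<^sup>+ x. ennreal (indicator {a..b} x * f x) \<partial>lborel)"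
    by (intro nn_integral_cong) (auto split: split_indicator)
  also have "\<dots> = ennreal (\<integral>x. f x \<partial>lebesgue_on {a..b})"
    using assms(2) has_integral_integral_lebesgue_on[OF i]
    by (intro nn_integral_has_integral_lebesgue) auto
  finally show ?thesis .
qed

text \<open>A positive eigenfunction \<open>\<phi>\<close> and a further eigenfunction \<open>\<psi>\<close>, with their classical derivatives on
  the edges, one-sided at the ends.\<close>

locale eigenfunction_pair =
  fixes \<Gamma> :: "('v, 'e) metric_graph" and \<mu>\<^sub>1 \<mu>\<^sub>2 :: real
    and \<phi> \<psi> :: "('v, 'e) point \<Rightarrow> real" and \<phi>' \<psi>' :: "'e \<Rightarrow> real \<Rightarrow> real"
  assumes \<Gamma>: "is_metric_graph \<Gamma>"
    and \<phi>: "\<phi> \<in> eigenspace \<Gamma> \<mu>\<^sub>1" and \<psi>: "\<psi> \<in> eigenspace \<Gamma> \<mu>\<^sub>2"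
    and \<phi>_pos: "\<And>p. p \<in> points \<Gamma> - Vertex ` dirichlet \<Gamma> \<Longrightarrow> \<phi> p > 0"
    and d\<phi>: "\<And>e x. \<lbrakk>e \<in> edges \<Gamma>; x \<in> {0..len \<Gamma> e}\<rbrakk> \<Longrightarrow>
      ((\<lambda>x. \<phi> (edge_point \<Gamma> e x)) has_real_derivative \<phi>' e x) (at x within {0..len \<Gamma> e})"
    and d\<phi>': "\<And>e x. \<lbrakk>e \<in> edges \<Gamma>; x \<in> {0..len \<Gamma> e}\<rbrakk> \<Longrightarrow>
      (\<phi>' e has_real_derivative - \<mu>\<^sub>1 * \<phi> (edge_point \<Gamma> e x)) (at x within {0..len \<Gamma> e})"
    and d\<psi>: "\<And>e x. \<lbrakk>e \<in> edges \<Gamma>; x \<in> {0..len \<Gamma> e}\<rbrakk> \<Longrightarrow>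
      ((\<lambda>x. \<psi> (edge_point \<Gamma> e x)) has_real_derivative \<psi>' e x) (at x within {0..len \<Gamma> e})"
    and d\<psi>': "\<And>e x. \<lbrakk>e \<in> edges \<Gamma>; x \<in> {0..len \<Gamma> e}\<rbrakk> \<Longrightarrow>
      (\<psi>' e has_real_derivative - \<mu>\<^sub>2 * \<psi> (edge_point \<Gamma> e x)) (at x within {0..len \<Gamma> e})"
begin

lemma continuous_on_edge:
  assumes "e \<in> edges \<Gamma>"
  shows "continuous_on {0..len \<Gamma> e} (\<lambda>x. \<phi> (edge_point \<Gamma> e x))" "continuous_on {0..len \<Gamma> e} (\<phi>' e)"
    "continuous_on {0..len \<Gamma> e} (\<lambda>x. \<psi> (edge_point \<Gamma> e x))" "continuous_on {0..len \<Gamma> e} (\<psi>' e)"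
  by (rule DERIV_continuous_on[OF d\<phi>[OF assms]] DERIV_continuous_on[OF d\<phi>'[OF assms]]
      DERIV_continuous_on[OF d\<psi>[OF assms]] DERIV_continuous_on[OF d\<psi>'[OF assms]]; assumption)+

lemma form_domain_zero:
  assumes "u \<in> form_domain \<Gamma>"
  shows "p \<notin> points \<Gamma> \<Longrightarrow> u p = 0" "w \<in> dirichlet \<Gamma> \<Longrightarrow> u (Vertex w) = 0"
  using assms unfolding form_domain_def graph_H1_def by auto

lemmas eigenfunctions_dom = eigenfunction_domain[OF \<Gamma> \<phi>] eigenfunction_domain[OF \<Gamma> \<psi>]

lemma \<phi>_nonneg: "0 \<le> \<phi> p"
proof (cases "p \<in> points \<Gamma> - Vertex ` dirichlet \<Gamma>")
  case True
  then show ?thesis using \<phi>_pos by (simp add: less_imp_le)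
next
  case False
  then show ?thesis using form_domain_zero[OF eigenfunctions_dom(1)] by auto
qed

lemma \<phi>_zero_imp: "\<phi> p = 0 \<Longrightarrow> \<psi> p = 0"
  using \<phi>_pos[of p] form_domain_zero[OF eigenfunctions_dom(2)] by (cases "p \<in> points \<Gamma> - Vertex ` dirichlet \<Gamma>") auto

lemma \<phi>_pos_edge: "\<lbrakk>e \<in> edges \<Gamma>; x \<in> {0<..<len \<Gamma> e}\<rbrakk> \<Longrightarrow> \<phi> (edge_point \<Gamma> e x) > 0"
  by (rule \<phi>_pos) (auto simp: points_def edge_point_def)

lemma \<phi>_L2: "e \<in> edges \<Gamma> \<Longrightarrow> has_L2_derivative (len \<Gamma> e) (\<phi> \<circ> edge_point \<Gamma> e) (\<phi>' e)"
  using C1_has_L2_derivative[OF continuous_on_edge(2) d\<phi>] by (simp add: comp_def)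

lemma \<psi>_L2: "e \<in> edges \<Gamma> \<Longrightarrow> has_L2_derivative (len \<Gamma> e) (\<psi> \<circ> edge_point \<Gamma> e) (\<psi>' e)"
  using C1_has_L2_derivative[OF continuous_on_edge(4) d\<psi>] by (simp add: comp_def)

text \<open>The square of the \<open>L\<^sup>2\<close> norm of the positive part of \<open>\<psi>\<close>.\<close>

definition sq_norm_pos_part :: real where
  "sq_norm_pos_part = (\<Sum>e\<in>edges \<Gamma>. \<integral>x. (max 0 (\<psi> (edge_point \<Gamma> e x)))\<^sup>2 \<partial>lebesgue_on {0..len \<Gamma> e})"

text \<open>In terms of \<open>f = \<psi> / \<phi>\<close> the integrand on the left is \<open>\<phi>\<^sup>2 f'\<^sup>2\<close>. At a Dirichlet vertex \<open>f\<close> is undefined, so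
  the weak equations are tested with \<open>r(\<psi>)\<close> and \<open>r(\<psi>)\<^sup>2 / (\<phi> + \<epsilon>)\<close>, with \<open>r\<close> the smoothed positive part;
  then \<open>\<epsilon> \<rightarrow> 0\<close>, with Fatou's lemma on the left and dominated convergence on the right.\<close>

lemma picone_energy:
  "(\<Sum>e\<in>edges \<Gamma>. \<integral>\<^sup>+ x. ennreal ((\<psi>' e x - \<psi> (edge_point \<Gamma> e x) * \<phi>' e x / \<phi> (edge_point \<Gamma> e x))\<^sup>2)
      * indicator {x \<in> {0<..<len \<Gamma> e}. \<psi> (edge_point \<Gamma> e x) > 0} x \<partial>lborel)
    \<le> ennreal ((\<mu>\<^sub>2 - \<mu>\<^sub>1) * sq_norm_pos_part)"
proof -
  define F where "F = (\<lambda>e x. \<phi> (edge_point \<Gamma> e x))"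
  define G where "G = (\<lambda>e x. \<psi> (edge_point \<Gamma> e x))"
  define P where "P = (\<lambda>e. {x \<in> {0<..<len \<Gamma> e}. G e x > 0})"
  define Q where "Q = (\<lambda>e x. (\<psi>' e x - G e x * \<phi>' e x / F e x)\<^sup>2)"
  define \<epsilon> where "\<epsilon> = (\<lambda>n. 1 / real (Suc n))"
  have \<epsilon>: "\<epsilon> n > 0" for n by (simp add: \<epsilon>_def)
  have \<epsilon>lim: "\<epsilon> \<longlonglongrightarrow> 0" unfolding \<epsilon>_def by (rule LIMSEQ_Suc) (rule lim_const_over_n)
  define v where "v = (\<lambda>n p. smooth_pos (\<epsilon> n) (\<psi> p))"
  define z where "z = (\<lambda>n p. (v n p)\<^sup>2 / (\<phi> p + \<epsilon> n))"
  define s where "s = (\<lambda>n e x. smooth_pos' (\<epsilon> n) (G e x))"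
  define V where "V = (\<lambda>n e x. v n (edge_point \<Gamma> e x))"
  define v' where "v' = (\<lambda>n e x. s n e x * \<psi>' e x)"
  define c where "c = (\<lambda>n e x. F e x + \<epsilon> n)"
  define z' where "z' = (\<lambda>n e x. 2 * V n e x * v' n e x / c n e x - (V n e x)\<^sup>2 * \<phi>' e x / (c n e x)\<^sup>2)"
  define H where "H = (\<lambda>n e x. (s n e x * \<psi>' e x - V n e x * \<phi>' e x / c n e x)\<^sup>2)"
  have cpos: "c n e x > 0" for n e x using \<phi>_nonneg \<epsilon> by (simp add: c_def F_def add_nonneg_pos)
  note bounds = smooth_pos_bounds[OF \<epsilon>]
  have v0: "v n p = 0" if "\<psi> p = 0" for n p
    using bounds(1,2)[of n 0] that by (simp add: v_def)
  have dF: "(F e has_real_derivative \<phi>' e x) (at x within {0..len \<Gamma> e})"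
    and dG: "(G e has_real_derivative \<psi>' e x) (at x within {0..len \<Gamma> e})"
    if "e \<in> edges \<Gamma>" "x \<in> {0..len \<Gamma> e}" for e x
    unfolding F_def G_def by (rule d\<phi>[OF that] d\<psi>[OF that])+
  have dV: "(V n e has_real_derivative v' n e x) (at x within {0..len \<Gamma> e})"
    if "e \<in> edges \<Gamma>" "x \<in> {0..len \<Gamma> e}" for n e x
    using DERIV_chain2[OF smooth_pos_deriv[OF \<epsilon>] dG[OF that], of n]
    by (simp add: V_def v_def v'_def s_def G_def)
  have dZ: "((\<lambda>x. z n (edge_point \<Gamma> e x)) has_real_derivative z' n e x) (at x within {0..len \<Gamma> e})"
    if "e \<in> edges \<Gamma>" "x \<in> {0..len \<Gamma> e}" for n e x
  proof -
    have dc: "((\<lambda>x. c n e x) has_real_derivative \<phi>' e x) (at x within {0..len \<Gamma> e})"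
      unfolding c_def using dF[OF that] by (auto intro!: derivative_eq_intros)
    have dV2: "((\<lambda>x. (V n e x)\<^sup>2) has_real_derivative 2 * V n e x * v' n e x) (at x within {0..len \<Gamma> e})"
      using dV[OF that] by (auto intro!: derivative_eq_intros)
    have c0: "c n e x \<noteq> 0" using cpos[of n e x] by simp
    have "((\<lambda>x. (V n e x)\<^sup>2 / c n e x) has_real_derivative z' n e x) (at x within {0..len \<Gamma> e})"
      using DERIV_divide[OF dV2 dc c0] c0 by (simp add: z'_def field_simps power2_eq_square)
    then show ?thesis by (simp add: V_def z_def c_def F_def)
  qed
  have cont: "continuous_on {0..len \<Gamma> e} (F e)" "continuous_on {0..len \<Gamma> e} (G e)"
    "continuous_on {0..len \<Gamma> e} (V n e)" "continuous_on {0..len \<Gamma> e} (c n e)"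
    "continuous_on {0..len \<Gamma> e} (s n e)" "continuous_on {0..len \<Gamma> e} (v' n e)"
    "continuous_on {0..len \<Gamma> e} (z' n e)" "continuous_on {0..len \<Gamma> e} (H n e)"
    if e: "e \<in> edges \<Gamma>" for n e
  proof -
    note [continuous_intros] = continuous_on_edge[OF e] continuous_on_smooth_pos'[OF \<epsilon>]
    show F: "continuous_on {0..len \<Gamma> e} (F e)" and G: "continuous_on {0..len \<Gamma> e} (G e)"
      unfolding F_def G_def by (intro continuous_intros)+
    show V: "continuous_on {0..len \<Gamma> e} (V n e)" by (rule DERIV_continuous_on[OF dV[OF e]])
    show c: "continuous_on {0..len \<Gamma> e} (c n e)" unfolding c_def by (intro continuous_intros F)
    show s: "continuous_on {0..len \<Gamma> e} (s n e)" unfolding s_def by (intro continuous_intros G)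
    show v': "continuous_on {0..len \<Gamma> e} (v' n e)" unfolding v'_def by (intro continuous_intros s)
    have c0: "\<forall>x\<in>{0..len \<Gamma> e}. c n e x \<noteq> 0" using cpos by (simp add: less_imp_neq[symmetric])
    then show "continuous_on {0..len \<Gamma> e} (z' n e)" "continuous_on {0..len \<Gamma> e} (H n e)"
      unfolding z'_def H_def by (intro continuous_intros V c v' s; simp)+
  qed
  have LV: "has_L2_derivative (len \<Gamma> e) (v n \<circ> edge_point \<Gamma> e) (v' n e)" if "e \<in> edges \<Gamma>" for n e
    using C1_has_L2_derivative[OF cont(6)[OF that] dV[OF that]] by (simp add: V_def comp_def)
  have LZ: "has_L2_derivative (len \<Gamma> e) (z n \<circ> edge_point \<Gamma> e) (z' n e)" if "e \<in> edges \<Gamma>" for n e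
    using C1_has_L2_derivative[OF cont(7)[OF that] dZ[OF that]] by (simp add: comp_def)
  have vdom: "v n \<in> form_domain \<Gamma>" for n
    by (rule form_domainI[OF \<Gamma> LV]) (use v0 form_domain_zero[OF eigenfunctions_dom(2)] in auto)
  have zdom: "z n \<in> form_domain \<Gamma>" for n
    by (rule form_domainI[OF \<Gamma> LZ]) (use v0 form_domain_zero[OF eigenfunctions_dom(2)] in \<open>auto simp: z_def\<close>)
  define R where "R = (\<lambda>n. \<mu>\<^sub>2 * (\<Sum>e\<in>edges \<Gamma>. \<integral>x. G e x * V n e x \<partial>lebesgue_on {0..len \<Gamma> e})
      - \<mu>\<^sub>1 * (\<Sum>e\<in>edges \<Gamma>. \<integral>x. F e x * z n (edge_point \<Gamma> e x) \<partial>lebesgue_on {0..len \<Gamma> e}))"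
  \<comment> \<open>subtract the two weak equations and apply Picone pointwise\<close>
  have energy: "(\<Sum>e\<in>edges \<Gamma>. \<integral>x. H n e x \<partial>lebesgue_on {0..len \<Gamma> e}) \<le> R n" for n
  proof -
    have "(\<Sum>e\<in>edges \<Gamma>. \<integral>x. H n e x \<partial>lebesgue_on {0..len \<Gamma> e})
      \<le> (\<Sum>e\<in>edges \<Gamma>. (\<integral>x. \<psi>' e x * v' n e x \<partial>lebesgue_on {0..len \<Gamma> e})
            - (\<integral>x. \<phi>' e x * z' n e x \<partial>lebesgue_on {0..len \<Gamma> e}))"
    proof (rule sum_mono)
      fix e assume e: "e \<in> edges \<Gamma>"
      let ?M = "lebesgue_on {0..len \<Gamma> e}"
      have i: "integrable ?M (\<lambda>x. \<psi>' e x * v' n e x)" "integrable ?M (\<lambda>x. \<phi>' e x * z' n e x)"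
        by (intro integrable_continuous_lebesgue_on continuous_on_mult continuous_on_edge[OF e] cont[OF e])+
      have "(\<integral>x. H n e x \<partial>?M) \<le> (\<integral>x. \<psi>' e x * v' n e x - \<phi>' e x * z' n e x \<partial>?M)"
      proof (rule integral_mono)
        show "integrable ?M (H n e)" by (intro integrable_continuous_lebesgue_on cont[OF e])
        show "integrable ?M (\<lambda>x. \<psi>' e x * v' n e x - \<phi>' e x * z' n e x)" using i by simp
        show "H n e x \<le> \<psi>' e x * v' n e x - \<phi>' e x * z' n e x" for x
          unfolding H_def v'_def z'_def s_def
          by (rule picone_pointwise[OF cpos bounds(3,4)])
      qed
      also have "\<dots> = (\<integral>x. \<psi>' e x * v' n e x \<partial>?M) - (\<integral>x. \<phi>' e x * z' n e x \<partial>?M)" using i by simp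
      finally show "(\<integral>x. H n e x \<partial>?M) \<le> (\<integral>x. \<psi>' e x * v' n e x \<partial>?M) - (\<integral>x. \<phi>' e x * z' n e x \<partial>?M)" .
    qed
    also have "\<dots> = R n"
      unfolding sum_subtractf R_def F_def G_def V_def
      by (simp only: eigenfunction_weak[OF \<Gamma> \<psi> \<psi>_L2 vdom LV] eigenfunction_weak[OF \<Gamma> \<phi> \<phi>_L2 zdom LZ])
    finally show ?thesis .
  qed
  \<comment> \<open>both products converge to the square of the positive part of \<open>\<psi>\<close>, which also dominates them\<close>
  have Rlim: "R \<longlonglongrightarrow> (\<mu>\<^sub>2 - \<mu>\<^sub>1) * sq_norm_pos_part"
  proof -
    have pp: "(\<lambda>n. \<integral>x. G e x * V n e x \<partial>lebesgue_on {0..len \<Gamma> e})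
          \<longlonglongrightarrow> (\<integral>x. (max 0 (G e x))\<^sup>2 \<partial>lebesgue_on {0..len \<Gamma> e})"
        "(\<lambda>n. \<integral>x. F e x * z n (edge_point \<Gamma> e x) \<partial>lebesgue_on {0..len \<Gamma> e})
          \<longlonglongrightarrow> (\<integral>x. (max 0 (G e x))\<^sup>2 \<partial>lebesgue_on {0..len \<Gamma> e})"
      if e: "e \<in> edges \<Gamma>" for e
    proof -
      let ?M = "lebesgue_on {0..len \<Gamma> e}"
      have i: "integrable ?M (\<lambda>x. (max 0 (G e x))\<^sup>2)"
        by (intro integrable_continuous_lebesgue_on continuous_intros cont[OF e])
      have Vlim: "(\<lambda>n. V n e x) \<longlonglongrightarrow> max 0 (G e x)" for x
        unfolding V_def v_def G_def by (rule smooth_pos_tendsto(1)[OF \<epsilon>lim])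
      have Vb: "0 \<le> V n e x" "V n e x \<le> max 0 (G e x)" for n x
        using bounds(1,2) by (auto simp: V_def v_def G_def)
      have V2: "(V n e x)\<^sup>2 \<le> (max 0 (G e x))\<^sup>2" for n x
        using Vb by (intro power_mono)
      have zV: "z n (edge_point \<Gamma> e x) = (V n e x)\<^sup>2 / c n e x" for n x
        by (simp add: z_def V_def c_def F_def)
      show "(\<lambda>n. \<integral>x. G e x * V n e x \<partial>?M) \<longlonglongrightarrow> (\<integral>x. (max 0 (G e x))\<^sup>2 \<partial>?M)"
      proof (rule integral_dominated_convergence[OF _ _ i])
        show "(\<lambda>x. G e x * V n e x) \<in> borel_measurable ?M" for n
          by (intro borel_measurable_integrable integrable_continuous_lebesgue_on continuous_intros cont[OF e])
        show "AE x in ?M. (\<lambda>n. G e x * V n e x) \<longlonglongrightarrow> (max 0 (G e x))\<^sup>2"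
        proof (rule AE_I2)
          fix x
          have "(\<lambda>n. G e x * V n e x) \<longlonglongrightarrow> G e x * max 0 (G e x)"
            by (intro tendsto_intros Vlim)
          moreover have "G e x * max 0 (G e x) = (max 0 (G e x))\<^sup>2"
            by (auto simp: max_def power2_eq_square)
          ultimately show "(\<lambda>n. G e x * V n e x) \<longlonglongrightarrow> (max 0 (G e x))\<^sup>2" by simp
        qed
        show "AE x in ?M. norm (G e x * V n e x) \<le> (max 0 (G e x))\<^sup>2" for n
        proof (rule AE_I2)
          fix x
          show "norm (G e x * V n e x) \<le> (max 0 (G e x))\<^sup>2"
          proof (cases "G e x > 0")
            case True
            then show ?thesis using Vb[of n x] by (simp add: abs_mult power2_eq_square mult_left_mono)
          next
            case False
            then have "V n e x = 0" using Vb[of n x] by simp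
            then show ?thesis by simp
          qed
        qed
      qed (use i in auto)
      show "(\<lambda>n. \<integral>x. F e x * z n (edge_point \<Gamma> e x) \<partial>?M) \<longlonglongrightarrow> (\<integral>x. (max 0 (G e x))\<^sup>2 \<partial>?M)"
        unfolding zV
      proof (rule integral_dominated_convergence[OF _ _ i])
        show "(\<lambda>x. F e x * ((V n e x)\<^sup>2 / c n e x)) \<in> borel_measurable ?M" for n
          using cpos[of n e]
          by (intro borel_measurable_integrable integrable_continuous_lebesgue_on continuous_intros cont[OF e])
             (simp add: less_imp_neq[symmetric])
        show "AE x in ?M. (\<lambda>n. F e x * ((V n e x)\<^sup>2 / c n e x)) \<longlonglongrightarrow> (max 0 (G e x))\<^sup>2"
        proof (rule AE_I2)
          fix x
          show "(\<lambda>n. F e x * ((V n e x)\<^sup>2 / c n e x)) \<longlonglongrightarrow> (max 0 (G e x))\<^sup>2"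
          \<comment> \<open>where \<open>\<phi>\<close> vanishes, so does \<open>\<psi>\<close>; on the graph this happens at Dirichlet vertices only\<close>
          proof (cases "F e x = 0")
            case True
            then have "G e x = 0" unfolding F_def G_def by (rule \<phi>_zero_imp)
            with True show ?thesis by simp
          next
            case False
            then have "(\<lambda>n. F e x * ((V n e x)\<^sup>2 / c n e x)) \<longlonglongrightarrow> F e x * ((max 0 (G e x))\<^sup>2 / (F e x + 0))"
              unfolding c_def by (intro tendsto_intros Vlim \<epsilon>lim) simp
            with False show ?thesis by simp
          qed
        qed
        show "AE x in ?M. norm (F e x * ((V n e x)\<^sup>2 / c n e x)) \<le> (max 0 (G e x))\<^sup>2" for n
        proof (rule AE_I2)
          fix x
          have F0: "0 \<le> F e x" by (simp add: F_def \<phi>_nonneg)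
          have "F e x / c n e x \<le> 1" using cpos[of n e x] \<epsilon>[of n] by (simp add: c_def)
          then have "(F e x / c n e x) * (V n e x)\<^sup>2 \<le> 1 * (V n e x)\<^sup>2"
            by (rule mult_right_mono) simp
          with F0 V2[of n x] cpos[of n e x]
          show "norm (F e x * ((V n e x)\<^sup>2 / c n e x)) \<le> (max 0 (G e x))\<^sup>2"
            by (simp add: abs_mult)
        qed
      qed (use i in auto)
    qed
    have "R \<longlonglongrightarrow> \<mu>\<^sub>2 * (\<Sum>e\<in>edges \<Gamma>. \<integral>x. (max 0 (G e x))\<^sup>2 \<partial>lebesgue_on {0..len \<Gamma> e})
      - \<mu>\<^sub>1 * (\<Sum>e\<in>edges \<Gamma>. \<integral>x. (max 0 (G e x))\<^sup>2 \<partial>lebesgue_on {0..len \<Gamma> e})"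
      unfolding R_def by (intro tendsto_intros pp)
    then show ?thesis unfolding sq_norm_pos_part_def G_def by (simp add: left_diff_distrib)
  qed
  have Popen: "open (P e)" if e: "e \<in> edges \<Gamma>" for e
  proof -
    have "open ({0<..<len \<Gamma> e} \<inter> G e -` {0<..})"
      by (rule continuous_open_preimage[OF continuous_on_subset[OF cont(2)[OF e]]]) auto
    moreover have "{0<..<len \<Gamma> e} \<inter> G e -` {0<..} = P e" by (auto simp: P_def)
    ultimately show ?thesis by simp
  qed
  define f where "f = (\<lambda>n x. \<Sum>e\<in>edges \<Gamma>. ennreal (H n e x) * indicator (P e) x)"
  have Hm: "(\<lambda>x. ennreal (H n e x) * indicator (P e) x) \<in> borel_measurable borel"
    if e: "e \<in> edges \<Gamma>" for n e
    using Popen[OF e]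
    by (intro borel_measurable_ennreal_indicator continuous_on_subset[OF cont(8)[OF e]])
       (auto simp: P_def)
  have flim: "(\<lambda>n. f n x) \<longlonglongrightarrow> (\<Sum>e\<in>edges \<Gamma>. ennreal (Q e x) * indicator (P e) x)" for x
    unfolding f_def
  proof (rule tendsto_sum)
    fix e assume e: "e \<in> edges \<Gamma>"
    show "(\<lambda>n. ennreal (H n e x) * indicator (P e) x) \<longlonglongrightarrow> ennreal (Q e x) * indicator (P e) x"
    proof (cases "x \<in> P e")
      case True
      then have x: "x \<in> {0<..<len \<Gamma> e}" "G e x > 0" by (auto simp: P_def)
      have F0: "F e x > 0" unfolding F_def by (rule \<phi>_pos_edge[OF e x(1)])
      have "(\<lambda>n. s n e x) \<longlonglongrightarrow> 1" unfolding s_def by (rule smooth_pos_tendsto(2)[OF \<epsilon>lim x(2)])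
      moreover have "(\<lambda>n. V n e x) \<longlonglongrightarrow> G e x"
        using smooth_pos_tendsto(1)[OF \<epsilon>lim, of "G e x"] x by (simp add: V_def v_def G_def)
      ultimately have "(\<lambda>n. H n e x) \<longlonglongrightarrow> (1 * \<psi>' e x - G e x * \<phi>' e x / (F e x + 0))\<^sup>2"
        unfolding H_def c_def using F0 by (intro tendsto_intros \<epsilon>lim) auto
      then show ?thesis using True by (auto simp: Q_def intro!: tendsto_ennrealI)
    qed simp
  qed
  have Qm: "(\<lambda>x. ennreal (Q e x) * indicator (P e) x) \<in> borel_measurable borel"
    if e: "e \<in> edges \<Gamma>" for e
  proof (rule borel_measurable_ennreal_indicator)
    have sub: "P e \<subseteq> {0..len \<Gamma> e}" by (auto simp: P_def)
    have "F e x \<noteq> 0" if "x \<in> P e" for x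
      using \<phi>_pos_edge[OF e, of x] that by (auto simp: P_def F_def)
    then show "continuous_on (P e) (Q e)"
      unfolding Q_def
      by (intro continuous_intros continuous_on_subset[OF continuous_on_edge(2)[OF e] sub]
          continuous_on_subset[OF continuous_on_edge(4)[OF e] sub]
          continuous_on_subset[OF cont(1)[OF e] sub] continuous_on_subset[OF cont(2)[OF e] sub]) auto
  qed (use Popen[OF e] in simp)
  have "(\<Sum>e\<in>edges \<Gamma>. \<integral>\<^sup>+ x. ennreal (Q e x) * indicator (P e) x \<partial>lborel)
      = (\<integral>\<^sup>+ x. (\<Sum>e\<in>edges \<Gamma>. ennreal (Q e x) * indicator (P e) x) \<partial>lborel)"
    by (rule nn_integral_sum[symmetric]) (use Qm in auto)
  also have "\<dots> = (\<integral>\<^sup>+ x. liminf (\<lambda>n. f n x) \<partial>lborel)"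
    using lim_imp_Liminf[OF _ flim] by simp
  also have "\<dots> \<le> liminf (\<lambda>n. \<integral>\<^sup>+ x. f n x \<partial>lborel)"
    by (rule nn_integral_liminf) (use Hm in \<open>auto simp: f_def\<close>)
  also have "\<dots> \<le> liminf (\<lambda>n. ennreal (R n))"
  proof (intro Liminf_mono always_eventually allI)
    fix n
    have "(\<integral>\<^sup>+ x. f n x \<partial>lborel) = (\<Sum>e\<in>edges \<Gamma>. \<integral>\<^sup>+ x. ennreal (H n e x) * indicator (P e) x \<partial>lborel)"
      unfolding f_def by (rule nn_integral_sum) (use Hm in auto)
    also have "\<dots> \<le> (\<Sum>e\<in>edges \<Gamma>. \<integral>\<^sup>+ x. ennreal (H n e x) * indicator {0..len \<Gamma> e} x \<partial>lborel)"
      by (intro sum_mono nn_integral_mono) (auto simp: P_def split: split_indicator)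
    also have "\<dots> = (\<Sum>e\<in>edges \<Gamma>. ennreal (\<integral>x. H n e x \<partial>lebesgue_on {0..len \<Gamma> e}))"
      by (intro sum.cong refl nn_integral_eq_lebesgue_on cont) (auto simp: H_def)
    also have "\<dots> = ennreal (\<Sum>e\<in>edges \<Gamma>. \<integral>x. H n e x \<partial>lebesgue_on {0..len \<Gamma> e})"
      by (rule sum_ennreal) (simp add: H_def)
    also have "\<dots> \<le> ennreal (R n)" by (rule ennreal_leI[OF energy])
    finally show "(\<integral>\<^sup>+ x. f n x \<partial>lborel) \<le> ennreal (R n)" .
  qed
  also have "\<dots> = ennreal ((\<mu>\<^sub>2 - \<mu>\<^sub>1) * sq_norm_pos_part)"
    by (rule lim_imp_Liminf) (auto intro!: tendsto_ennrealI Rlim)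
  finally show ?thesis unfolding Q_def P_def F_def G_def .
qed

end

section \<open>Level sets as cuts\<close>

lemma zero_integral_imp_zero:
  fixes f :: "real \<Rightarrow> real"
  assumes "a < b" "continuous_on {a..b} f" "\<And>x. x \<in> {a..b} \<Longrightarrow> 0 \<le> f x"
    and "(\<integral>x. f x \<partial>lebesgue_on {a..b}) = 0" and x: "x \<in> {a..b}"
  shows "f x = 0"
proof -
  have "integral {a..b} f = 0"
    using assms(4) lebesgue_integral_eq_integral[OF integrable_continuous_lebesgue_on[OF assms(2)]]
    by simp
  then show ?thesis
    using integral_cbox_eq_0_iff[of a b f] assms(1,2,3) x by simp
qed

text \<open>Every vertex has positive degree, so there are no isolated vertices.\<close>

lemma edge_covering:
  assumes \<Gamma>: "is_metric_graph \<Gamma>" and p: "p \<in> points \<Gamma>"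
  obtains e x where "e \<in> edges \<Gamma>" "x \<in> {0..len \<Gamma> e}" "p = edge_point \<Gamma> e x"
proof (cases p)
  case (Inner e x)
  with p have "e \<in> edges \<Gamma>" "0 < x" "x < len \<Gamma> e" by (auto simp: points_def)
  then show thesis using Inner by (intro that[of e x]) (auto simp: edge_point_def)
next
  case (Vertex v)
  with p have v: "v \<in> vertices \<Gamma>" by (auto simp: points_def)
  have "vertex_degree \<Gamma> v \<ge> 1"
    using \<Gamma> v unfolding is_metric_graph_def by (cases "v \<in> dirichlet \<Gamma>") force+
  then have "in_arcs (skeleton \<Gamma>) v \<noteq> {} \<or> out_arcs (skeleton \<Gamma>) v \<noteq> {}"
    unfolding vertex_degree_def in_degree_def out_degree_def by auto
  then obtain e where e: "e \<in> edges \<Gamma>" "head (skeleton \<Gamma>) e = v \<or> tail (skeleton \<Gamma>) e = v"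
    by (auto simp: in_arcs_def out_arcs_def)
  have "0 < len \<Gamma> e" by (rule len_pos[OF \<Gamma> e(1)])
  then show thesis
    using e Vertex by (auto simp: edge_point_def intro: that[of e 0] that[of e "len \<Gamma> e"])
qed

lemma integral_over_nonneg:
  assumes "\<And>p. 0 \<le> f p"
  shows "0 \<le> integral_over \<Gamma> Y f"
  unfolding integral_over_def by (intro sum_nonneg Bochner_Integration.integral_nonneg assms)

lemma integral_over_empty: "integral_over \<Gamma> {} f = 0"
  by (simp add: integral_over_def)

lemma cheeger_le:
  assumes "is_cut \<Gamma> S Y\<^sub>1 Y\<^sub>2"
  shows "cheeger \<Gamma> \<phi> \<le> (\<Sum>q\<in>S. (\<phi> q)\<^sup>2) /
    min (integral_over \<Gamma> Y\<^sub>1 (\<lambda>p. (\<phi> p)\<^sup>2)) (integral_over \<Gamma> Y\<^sub>2 (\<lambda>p. (\<phi> p)\<^sup>2))"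
  unfolding cheeger_def
proof (rule cInf_lower)
  show "bdd_below {(\<Sum>q\<in>S. (\<phi> q)\<^sup>2) /
    min (integral_over \<Gamma> Y\<^sub>1 (\<lambda>p. (\<phi> p)\<^sup>2)) (integral_over \<Gamma> Y\<^sub>2 (\<lambda>p. (\<phi> p)\<^sup>2)) |S Y\<^sub>1 Y\<^sub>2.
    is_cut \<Gamma> S Y\<^sub>1 Y\<^sub>2}"
    by (rule bdd_belowI[of _ 0])
       (auto intro!: divide_nonneg_nonneg sum_nonneg integral_over_nonneg simp: min_le_iff_disj)
qed (use assms in blast)

lemma cheeger_nonneg:
  assumes "is_cut \<Gamma> S Y\<^sub>1 Y\<^sub>2"
  shows "0 \<le> cheeger \<Gamma> \<phi>"
  unfolding cheeger_def
proof (rule cInf_greatest)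
  fix c assume "c \<in> {(\<Sum>q\<in>S. (\<phi> q)\<^sup>2) /
    min (integral_over \<Gamma> Y\<^sub>1 (\<lambda>p. (\<phi> p)\<^sup>2)) (integral_over \<Gamma> Y\<^sub>2 (\<lambda>p. (\<phi> p)\<^sup>2)) |S Y\<^sub>1 Y\<^sub>2.
    is_cut \<Gamma> S Y\<^sub>1 Y\<^sub>2}"
  then show "0 \<le> c"
    by (auto intro!: divide_nonneg_nonneg sum_nonneg integral_over_nonneg simp: min_le_iff_disj)
qed (use assms in blast)

context eigenfunction_pair
begin

text \<open>The measure with density \<open>\<phi>\<^sup>2\<close> whose values are compared in the Cheeger quotient.\<close>

definition mass :: "('v, 'e) point set \<Rightarrow> real" where
  "mass Y = integral_over \<Gamma> Y (\<lambda>p. (\<phi> p)\<^sup>2)"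

lemma mass_nonneg: "0 \<le> mass Y"
  unfolding mass_def by (rule integral_over_nonneg) simp

lemma edge_preimage_borel:
  assumes "openin (graph_topology \<Gamma>) Y" "e \<in> edges \<Gamma>"
  shows "{x \<in> {0..len \<Gamma> e}. edge_point \<Gamma> e x \<in> Y} \<in> sets borel"
proof -
  have "openin (top_of_set {0..len \<Gamma> e}) {x \<in> {0..len \<Gamma> e}. edge_point \<Gamma> e x \<in> Y}"
    using assms unfolding openin_graph_topology by blast
  then obtain T where T: "open T" "{x \<in> {0..len \<Gamma> e}. edge_point \<Gamma> e x \<in> Y} = {0..len \<Gamma> e} \<inter> T"
    unfolding openin_open by blast
  show ?thesis unfolding T(2) using T(1) by (intro sets.Int) auto
qed

lemma mass_eq_nn_integral:
  assumes Y: "openin (graph_topology \<Gamma>) Y"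
  shows "ennreal (mass Y) = (\<Sum>e\<in>edges \<Gamma>. \<integral>\<^sup>+ x. ennreal ((\<phi> (edge_point \<Gamma> e x))\<^sup>2)
      * indicator {x \<in> {0..len \<Gamma> e}. edge_point \<Gamma> e x \<in> Y} x \<partial>lborel)"
proof -
  define A where "A = (\<lambda>e. {x \<in> {0..len \<Gamma> e}. edge_point \<Gamma> e x \<in> Y})"
  have edge: "ennreal (\<integral>x. (\<phi> (edge_point \<Gamma> e x))\<^sup>2 \<partial>lebesgue_on (A e))
      = (\<integral>\<^sup>+ x. ennreal ((\<phi> (edge_point \<Gamma> e x))\<^sup>2) * indicator (A e) x \<partial>lborel)" if e: "e \<in> edges \<Gamma>" for e
  proof -
    let ?f = "\<lambda>x. (\<phi> (edge_point \<Gamma> e x))\<^sup>2"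
    have A: "A e \<in> sets borel" unfolding A_def by (rule edge_preimage_borel[OF Y e])
    then have AL: "A e \<in> sets lebesgue" by simp
    have sub: "A e \<subseteq> {0..len \<Gamma> e}" by (auto simp: A_def)
    have "integrable (lebesgue_on {0..len \<Gamma> e}) ?f"
      by (intro integrable_continuous_lebesgue_on continuous_intros continuous_on_edge[OF e])
    then have "integrable (lebesgue_on (A e)) ?f"
    proof -
      assume "integrable (lebesgue_on {0..len \<Gamma> e}) ?f"
      then have "integrable lebesgue (\<lambda>x. indicator {0..len \<Gamma> e} x *\<^sub>R ?f x)"
        by (simp add: integrable_restrict_space)
      from integrable_mult_indicator[OF AL this]
      have "integrable lebesgue (\<lambda>x. indicator (A e) x *\<^sub>R ?f x)"
        by (rule Bochner_Integration.integrable_cong[THEN iffD1, rotated 2])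
           (use sub in \<open>auto split: split_indicator\<close>)
      then show ?thesis using AL by (simp add: integrable_restrict_space)
    qed
    then have "(?f has_integral (\<integral>x. ?f x \<partial>lebesgue_on (A e))) (A e)"
      by (rule has_integral_integral_lebesgue_on[OF _ AL])
    then have "(\<integral>\<^sup>+ x. ennreal (indicator (A e) x * ?f x) \<partial>lborel) = ennreal (\<integral>x. ?f x \<partial>lebesgue_on (A e))"
      by (intro nn_integral_has_integral_lebesgue) auto
    moreover have "(\<integral>\<^sup>+ x. ennreal (indicator (A e) x * ?f x) \<partial>lborel) = (\<integral>\<^sup>+ x. ennreal (?f x) * indicator (A e) x \<partial>lborel)"
      by (intro nn_integral_cong) (auto split: split_indicator)
    ultimately show ?thesis by simp
  qed
  have "ennreal (mass Y) = (\<Sum>e\<in>edges \<Gamma>. ennreal (\<integral>x. (\<phi> (edge_point \<Gamma> e x))\<^sup>2 \<partial>lebesgue_on (A e)))"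
    unfolding mass_def integral_over_def A_def by (rule sum_ennreal[symmetric]) simp
  also have "\<dots> = (\<Sum>e\<in>edges \<Gamma>. \<integral>\<^sup>+ x. ennreal ((\<phi> (edge_point \<Gamma> e x))\<^sup>2) * indicator (A e) x \<partial>lborel)"
    by (intro sum.cong refl edge)
  finally show ?thesis unfolding A_def .
qed

lemma mass_mono:
  assumes "openin (graph_topology \<Gamma>) Y" "openin (graph_topology \<Gamma>) Z" "Y \<subseteq> Z"
  shows "mass Y \<le> mass Z"
proof -
  have "ennreal (mass Y) \<le> ennreal (mass Z)"
    unfolding mass_eq_nn_integral[OF assms(1)] mass_eq_nn_integral[OF assms(2)]
    using assms(3) by (intro sum_mono nn_integral_mono) (auto split: split_indicator)
  then show ?thesis using mass_nonneg by simp
qed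

text \<open>The level sets of \<open>\<psi> / \<phi>\<close>, written without division. This makes them open and closed, respectively,
  also at Dirichlet vertices; those belong to every level, and contribute nothing to a sum of \<open>\<phi>\<^sup>2\<close>.\<close>

definition super_level :: "real \<Rightarrow> ('v, 'e) point set" where
  "super_level s = {p \<in> points \<Gamma>. \<psi> p > s * \<phi> p}"

definition sub_level :: "real \<Rightarrow> ('v, 'e) point set" where
  "sub_level s = {p \<in> points \<Gamma>. \<psi> p < s * \<phi> p}"

definition level :: "real \<Rightarrow> ('v, 'e) point set" where
  "level s = {p \<in> points \<Gamma>. \<psi> p = s * \<phi> p}"

lemma open_levels:
  "openin (graph_topology \<Gamma>) (super_level s)" "openin (graph_topology \<Gamma>) (sub_level s)"
proof -
  have c: "continuous_map (graph_topology \<Gamma>) euclideanreal (\<lambda>p. \<psi> p - s * \<phi> p)"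
    unfolding continuous_map_graph_iff[OF \<Gamma>] comp_def
    by (intro ballI continuous_intros continuous_on_edge)
  have "super_level s = {p \<in> topspace (graph_topology \<Gamma>). \<psi> p - s * \<phi> p \<in> {0<..}}"
    "sub_level s = {p \<in> topspace (graph_topology \<Gamma>). \<psi> p - s * \<phi> p \<in> {..<0}}"
    unfolding super_level_def sub_level_def topspace_graph[OF \<Gamma>] by auto
  then show "openin (graph_topology \<Gamma>) (super_level s)" "openin (graph_topology \<Gamma>) (sub_level s)"
    by (auto simp del: greaterThan_iff lessThan_iff intro!: openin_continuous_map_preimage[OF c])
qed

lemma L2_norm_pos:
  "0 < (\<Sum>e\<in>edges \<Gamma>. \<integral>x. (\<phi> (edge_point \<Gamma> e x))\<^sup>2 \<partial>lebesgue_on {0..len \<Gamma> e})"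
proof -
  obtain w where "w \<in> vertices \<Gamma>" using \<Gamma> unfolding is_metric_graph_def by blast
  then have "Vertex w \<in> points \<Gamma>" by (simp add: points_def)
  then obtain e where e: "e \<in> edges \<Gamma>" by (rule edge_covering[OF \<Gamma>])
  have l: "0 < len \<Gamma> e" by (rule len_pos[OF \<Gamma> e])
  have "0 \<noteq> (\<integral>x. (\<phi> (edge_point \<Gamma> e x))\<^sup>2 \<partial>lebesgue_on {0..len \<Gamma> e})"
  proof
    assume 0: "0 = (\<integral>x. (\<phi> (edge_point \<Gamma> e x))\<^sup>2 \<partial>lebesgue_on {0..len \<Gamma> e})"
    have "(\<phi> (edge_point \<Gamma> e (len \<Gamma> e / 2)))\<^sup>2 = 0"
      by (rule zero_integral_imp_zero[OF l _ _ 0[symmetric]])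
         (use l in \<open>auto intro!: continuous_intros continuous_on_edge[OF e]\<close>)
    moreover have "\<phi> (edge_point \<Gamma> e (len \<Gamma> e / 2)) > 0" by (rule \<phi>_pos_edge[OF e]) (use l in auto)
    ultimately show False by simp
  qed
  then show ?thesis
    by (intro sum_pos2[OF finite_edges[OF \<Gamma>] e]) (auto simp: order_less_le)
qed

lemma first_eigenvalue_nonneg: "0 \<le> \<mu>\<^sub>1"
proof -
  have "0 \<le> (\<Sum>e\<in>edges \<Gamma>. \<integral>x. \<phi>' e x * \<phi>' e x \<partial>lebesgue_on {0..len \<Gamma> e})"
    by (intro sum_nonneg Bochner_Integration.integral_nonneg) simp
  also have "\<dots> = \<mu>\<^sub>1 * (\<Sum>e\<in>edges \<Gamma>. \<integral>x. (\<phi> (edge_point \<Gamma> e x))\<^sup>2 \<partial>lebesgue_on {0..len \<Gamma> e})"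
    using eigenfunction_weak[OF \<Gamma> \<phi> \<phi>_L2 eigenfunctions_dom(1) \<phi>_L2] by (simp add: power2_eq_square)
  finally show ?thesis using L2_norm_pos by (simp add: zero_le_mult_iff)
qed

lemma orthogonal:
  assumes "\<mu>\<^sub>1 \<noteq> \<mu>\<^sub>2"
  shows "(\<Sum>e\<in>edges \<Gamma>. \<integral>x. \<phi> (edge_point \<Gamma> e x) * \<psi> (edge_point \<Gamma> e x) \<partial>lebesgue_on {0..len \<Gamma> e}) = 0"
  using eigenfunction_weak[OF \<Gamma> \<phi> \<phi>_L2 eigenfunctions_dom(2) \<psi>_L2] eigenfunction_weak[OF \<Gamma> \<psi> \<psi>_L2 eigenfunctions_dom(1) \<phi>_L2] assms
  by (simp add: mult.commute)

text \<open>On an edge, \<open>D = \<psi> - s \<phi>\<close> satisfies \<open>D'' + \<mu>\<^sub>2 D = - (\<mu>\<^sub>2 - \<mu>\<^sub>1) s \<phi> < 0\<close>.\<close>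

lemma finite_level:
  assumes gap: "\<mu>\<^sub>1 < \<mu>\<^sub>2" and s: "0 < s"
  shows "finite (level s)"
proof -
  have fin: "finite {x \<in> {0..len \<Gamma> e}. \<psi> (edge_point \<Gamma> e x) - s * \<phi> (edge_point \<Gamma> e x) = 0}"
    if e: "e \<in> edges \<Gamma>" for e
  proof (rule finite_zeros_strict_supersolution)
    show "0 < \<mu>\<^sub>2" using gap first_eigenvalue_nonneg by simp
    show "((\<lambda>x. \<psi> (edge_point \<Gamma> e x) - s * \<phi> (edge_point \<Gamma> e x)) has_real_derivative
        \<psi>' e x - s * \<phi>' e x) (at x within {0..len \<Gamma> e})" if "x \<in> {0..len \<Gamma> e}" for x
      using d\<psi>[OF e that] d\<phi>[OF e that] by (intro DERIV_diff DERIV_cmult)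
    show "((\<lambda>x. \<psi>' e x - s * \<phi>' e x) has_real_derivative
        - \<mu>\<^sub>2 * \<psi> (edge_point \<Gamma> e x) - s * (- \<mu>\<^sub>1 * \<phi> (edge_point \<Gamma> e x))) (at x within {0..len \<Gamma> e})"
      if "x \<in> {0..len \<Gamma> e}" for x
      using d\<psi>'[OF e that] d\<phi>'[OF e that] by (intro DERIV_diff DERIV_cmult)
    show "- \<mu>\<^sub>2 * \<psi> (edge_point \<Gamma> e x) - s * (- \<mu>\<^sub>1 * \<phi> (edge_point \<Gamma> e x))
        + \<mu>\<^sub>2 * (\<psi> (edge_point \<Gamma> e x) - s * \<phi> (edge_point \<Gamma> e x)) < 0"
      if x: "x \<in> {0<..<len \<Gamma> e}" for x
    proof -
      have "0 < (\<mu>\<^sub>2 - \<mu>\<^sub>1) * (s * \<phi> (edge_point \<Gamma> e x))"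
        using gap s \<phi>_pos_edge[OF e x] by simp
      then show ?thesis by (simp add: algebra_simps)
    qed
  qed
  have "level s \<subseteq> (\<Union>e\<in>edges \<Gamma>. edge_point \<Gamma> e `
      {x \<in> {0..len \<Gamma> e}. \<psi> (edge_point \<Gamma> e x) - s * \<phi> (edge_point \<Gamma> e x) = 0})"
  proof
    fix p assume p: "p \<in> level s"
    then have "p \<in> points \<Gamma>" by (simp add: level_def)
    then obtain e x where ex: "e \<in> edges \<Gamma>" "x \<in> {0..len \<Gamma> e}" "p = edge_point \<Gamma> e x"
      by (rule edge_covering[OF \<Gamma>])
    with p have "x \<in> {x \<in> {0..len \<Gamma> e}. \<psi> (edge_point \<Gamma> e x) - s * \<phi> (edge_point \<Gamma> e x) = 0}"
      by (simp add: level_def)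
    with ex show "p \<in> (\<Union>e\<in>edges \<Gamma>. edge_point \<Gamma> e `
      {x \<in> {0..len \<Gamma> e}. \<psi> (edge_point \<Gamma> e x) - s * \<phi> (edge_point \<Gamma> e x) = 0})" by blast
  qed
  then show ?thesis
    by (rule finite_subset) (use fin finite_edges[OF \<Gamma>] in auto)
qed

text \<open>If the region \<open>\<psi> > 0\<close> has no more mass than the region \<open>\<psi> < 0\<close>, then at every positive level the
  superlevel set is the smaller side of the cut.\<close>

lemma level_cut:
  assumes gap: "\<mu>\<^sub>1 < \<mu>\<^sub>2" and s: "0 < s" and half: "mass (super_level 0) \<le> mass (sub_level 0)"
    and pos: "0 < mass (super_level s)"
  shows "is_cut \<Gamma> (level s) (super_level s) (sub_level s)" "mass (super_level s) \<le> mass (sub_level s)"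
proof -
  have nn: "0 \<le> s * \<phi> p" for p using s \<phi>_nonneg by simp
  have sub: "super_level s \<subseteq> super_level 0" "sub_level 0 \<subseteq> sub_level s"
    unfolding super_level_def sub_level_def
    by (auto intro: le_less_trans[OF nn] less_le_trans[OF _ nn])
  have "mass (super_level s) \<le> mass (super_level 0)" "mass (sub_level 0) \<le> mass (sub_level s)"
    by (intro mass_mono open_levels sub)+
  with half show le: "mass (super_level s) \<le> mass (sub_level s)" by linarith
  have "mass {} = 0" by (simp add: mass_def integral_over_empty)
  with le pos have "super_level s \<noteq> {}" "sub_level s \<noteq> {}" by auto
  then show "is_cut \<Gamma> (level s) (super_level s) (sub_level s)"
    using finite_level[OF gap s] open_levels unfolding is_cut_def
    by (auto simp: level_def super_level_def sub_level_def)
qed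

text \<open>The inequality holds trivially at the levels above the range of \<open>\<psi> / \<phi>\<close>, which yield no cut.\<close>

lemma cheeger_level:
  assumes gap: "\<mu>\<^sub>1 < \<mu>\<^sub>2" and s: "0 < s" and half: "mass (super_level 0) \<le> mass (sub_level 0)"
  shows "cheeger \<Gamma> \<phi> * mass (super_level s) \<le> (\<Sum>p\<in>level s. (\<phi> p)\<^sup>2)"
proof (cases "mass (super_level s) = 0")
  case True
  then show ?thesis by (simp add: sum_nonneg)
next
  case False
  then have pos: "0 < mass (super_level s)" using mass_nonneg[of "super_level s"] by simp
  note cut = level_cut[OF gap s half pos]
  have "cheeger \<Gamma> \<phi> \<le> (\<Sum>p\<in>level s. (\<phi> p)\<^sup>2) / mass (super_level s)"
    using cheeger_le[OF cut(1), of \<phi>] cut(2) by (simp add: mass_def[symmetric] min_absorb1)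
  then show ?thesis using pos by (simp add: pos_le_divide_eq)
qed

end

section \<open>Integration over the levels\<close>

context eigenfunction_pair
begin

text \<open>For \<open>\<psi> > 0\<close> the \<open>t > 0\<close> with \<open>\<psi> > \<phi> \<surd>t\<close> form an interval of length \<open>(\<psi> / \<phi>)\<^sup>2\<close>. Levels are therefore
  parametrised by the square \<open>t\<close> of the value of \<open>\<psi> / \<phi>\<close>.\<close>

lemma layer_cake_edge:
  assumes e: "e \<in> edges \<Gamma>"
  defines "K \<equiv> \<lambda>t x. if 0 < t \<and> x \<in> {0..len \<Gamma> e} \<and> edge_point \<Gamma> e x \<in> super_level (sqrt t)
      then ennreal ((\<phi> (edge_point \<Gamma> e x))\<^sup>2) else 0"
  shows "(\<lambda>t. \<integral>\<^sup>+ x. K t x \<partial>lborel) \<in> borel_measurable borel"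
    and "(\<integral>\<^sup>+ t. \<integral>\<^sup>+ x. K t x \<partial>lborel \<partial>lborel)
      = ennreal (\<integral>x. (max 0 (\<psi> (edge_point \<Gamma> e x)))\<^sup>2 \<partial>lebesgue_on {0..len \<Gamma> e})"
proof -
  define F where "F = (\<lambda>x. indicator {0..len \<Gamma> e} x *\<^sub>R \<phi> (edge_point \<Gamma> e x))"
  define G where "G = (\<lambda>x. indicator {0..len \<Gamma> e} x *\<^sub>R \<psi> (edge_point \<Gamma> e x))"
  have [measurable]: "F \<in> borel_measurable borel" "G \<in> borel_measurable borel"
    unfolding F_def G_def by (intro borel_measurable_continuous_on_indicator continuous_on_edge[OF e]; simp)+
  have K: "K t x = (if 0 < t \<and> x \<in> {0..len \<Gamma> e} \<and> sqrt t * F x < G x then ennreal ((F x)\<^sup>2) else 0)" for t x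
    using edge_point_in_points[OF \<Gamma> e, of x] by (auto simp: K_def F_def G_def super_level_def)
  have Km: "(\<lambda>(t, x). K t x) \<in> borel_measurable (lborel \<Otimes>\<^sub>M lborel)"
    unfolding K by measurable
  then show "(\<lambda>t. \<integral>\<^sup>+ x. K t x \<partial>lborel) \<in> borel_measurable borel"
    using lborel.borel_measurable_nn_integral[of K lborel] by simp
  have inner: "(\<integral>\<^sup>+ t. K t x \<partial>lborel) = ennreal ((max 0 (\<psi> (edge_point \<Gamma> e x)))\<^sup>2) * indicator {0..len \<Gamma> e} x" for x
  proof (cases "x \<in> {0..len \<Gamma> e}")
    case False
    then have "K t x = 0" for t by (auto simp: K)
    with False show ?thesis by simp
  next
    case x: True
    define f where "f = \<phi> (edge_point \<Gamma> e x)"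
    define g where "g = \<psi> (edge_point \<Gamma> e x)"
    have Kx: "K t x = (if 0 < t \<and> sqrt t * f < g then ennreal (f\<^sup>2) else 0)" for t
      using x by (simp add: K F_def G_def f_def g_def)
    have f0: "0 \<le> f" by (simp add: f_def \<phi>_nonneg)
    show ?thesis
    proof (cases "g > 0")
      case False
      have "K t x = 0" for t
      proof (cases "0 < t")
        case True
        then have "0 \<le> sqrt t * f" using f0 by simp
        then show ?thesis using False by (simp add: Kx)
      qed (simp add: Kx)
      then show ?thesis using False x by (simp add: g_def[symmetric])
    next
      case True
      have "f \<noteq> 0" using \<phi>_zero_imp[of "edge_point \<Gamma> e x"] True by (auto simp: f_def g_def)
      with f0 have f: "f > 0" by simp
      have "(0 < t \<and> sqrt t * f < g) \<longleftrightarrow> t \<in> {0<..<(g / f)\<^sup>2}" for t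
      proof -
        have "sqrt t * f < g \<longleftrightarrow> sqrt t < g / f" using f by (simp add: pos_less_divide_eq)
        also have "\<dots> \<longleftrightarrow> sqrt t < sqrt ((g / f)\<^sup>2)" using f True by simp
        finally show ?thesis by (simp del: real_sqrt_abs)
      qed
      then have "(\<integral>\<^sup>+ t. K t x \<partial>lborel) = (\<integral>\<^sup>+ t. ennreal (f\<^sup>2) * indicator {0<..<(g / f)\<^sup>2} t \<partial>lborel)"
        by (intro nn_integral_cong) (auto simp: Kx split: split_indicator)
      also have "\<dots> = ennreal (f\<^sup>2) * ennreal ((g / f)\<^sup>2)"
        by (subst nn_integral_cmult_indicator) auto
      also have "\<dots> = ennreal (g\<^sup>2)"
        using f by (simp add: ennreal_mult'[symmetric] power_divide)
      finally show ?thesis using x True by (simp add: g_def[symmetric])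
    qed
  qed
  have "(\<integral>\<^sup>+ t. \<integral>\<^sup>+ x. K t x \<partial>lborel \<partial>lborel) = (\<integral>\<^sup>+ x. \<integral>\<^sup>+ t. K t x \<partial>lborel \<partial>lborel)"
    by (rule lborel_pair.Fubini'[symmetric]) (use Km in simp)
  also have "\<dots> = (\<integral>\<^sup>+ x. ennreal ((max 0 (\<psi> (edge_point \<Gamma> e x)))\<^sup>2) * indicator {0..len \<Gamma> e} x \<partial>lborel)"
    by (simp only: inner)
  also have "\<dots> = ennreal (\<integral>x. (max 0 (\<psi> (edge_point \<Gamma> e x)))\<^sup>2 \<partial>lebesgue_on {0..len \<Gamma> e})"
    by (intro nn_integral_eq_lebesgue_on continuous_intros continuous_on_edge[OF e]) simp
  finally show "(\<integral>\<^sup>+ t. \<integral>\<^sup>+ x. K t x \<partial>lborel \<partial>lborel)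
      = ennreal (\<integral>x. (max 0 (\<psi> (edge_point \<Gamma> e x)))\<^sup>2 \<partial>lebesgue_on {0..len \<Gamma> e})" .
qed

lemma layer_cake:
  "(\<lambda>t. indicator {0<..} t * ennreal (mass (super_level (sqrt t)))) \<in> borel_measurable borel"
  "(\<integral>\<^sup>+ t. indicator {0<..} t * ennreal (mass (super_level (sqrt t))) \<partial>lborel) = ennreal sq_norm_pos_part"
proof -
  define K where "K = (\<lambda>e t x. if 0 < t \<and> x \<in> {0..len \<Gamma> e} \<and> edge_point \<Gamma> e x \<in> super_level (sqrt t)
      then ennreal ((\<phi> (edge_point \<Gamma> e x))\<^sup>2) else 0)"
  have edge: "(\<lambda>t. \<integral>\<^sup>+ x. K e t x \<partial>lborel) \<in> borel_measurable borel"
    "(\<integral>\<^sup>+ t. \<integral>\<^sup>+ x. K e t x \<partial>lborel \<partial>lborel)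
      = ennreal (\<integral>x. (max 0 (\<psi> (edge_point \<Gamma> e x)))\<^sup>2 \<partial>lebesgue_on {0..len \<Gamma> e})"
    if "e \<in> edges \<Gamma>" for e
    unfolding K_def by (rule layer_cake_edge[OF that])+
  have K: "(\<lambda>t. indicator {0<..} t * ennreal (mass (super_level (sqrt t))))
      = (\<lambda>t. \<Sum>e\<in>edges \<Gamma>. \<integral>\<^sup>+ x. K e t x \<partial>lborel)"
  proof
    fix t :: real
    show "indicator {0<..} t * ennreal (mass (super_level (sqrt t))) = (\<Sum>e\<in>edges \<Gamma>. \<integral>\<^sup>+ x. K e t x \<partial>lborel)"
    proof (cases "0 < t")
      case True
      have "(\<Sum>e\<in>edges \<Gamma>. \<integral>\<^sup>+ x. K e t x \<partial>lborel) = ennreal (mass (super_level (sqrt t)))"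
        unfolding mass_eq_nn_integral[OF open_levels(1)]
        by (intro sum.cong refl nn_integral_cong) (use True in \<open>auto simp: K_def split: split_indicator\<close>)
      with True show ?thesis by simp
    next
      case False
      then have "K e t x = 0" for e x by (simp add: K_def)
      with False show ?thesis by simp
    qed
  qed
  show "(\<lambda>t. indicator {0<..} t * ennreal (mass (super_level (sqrt t)))) \<in> borel_measurable borel"
    unfolding K by (intro borel_measurable_sum edge(1))
  show "(\<integral>\<^sup>+ t. indicator {0<..} t * ennreal (mass (super_level (sqrt t))) \<partial>lborel) = ennreal sq_norm_pos_part"
    unfolding K sq_norm_pos_part_def using edge
    by (subst nn_integral_sum) (auto simp: sum_ennreal)
qed

text \<open>At a level that is not attained at a vertex with \<open>\<phi> \<noteq> 0\<close>, only interior points of edges contribute.\<close>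

lemma level_sum:
  assumes off: "\<And>w. \<lbrakk>w \<in> vertices \<Gamma>; \<phi> (Vertex w) \<noteq> 0\<rbrakk> \<Longrightarrow> \<psi> (Vertex w) \<noteq> s * \<phi> (Vertex w)"
    and fin: "finite (level s)"
  defines "T \<equiv> \<lambda>e. {x \<in> {0<..<len \<Gamma> e}. \<psi> (edge_point \<Gamma> e x) = s * \<phi> (edge_point \<Gamma> e x)}"
  shows "(\<Sum>p\<in>level s. (\<phi> p)\<^sup>2) = (\<Sum>e\<in>edges \<Gamma>. \<Sum>x\<in>T e. (\<phi> (edge_point \<Gamma> e x))\<^sup>2)"
    and "\<And>e. e \<in> edges \<Gamma> \<Longrightarrow> finite (T e)"
proof -
  define J :: "('v, 'e) point set" where "J = (\<lambda>(e, x). Inner e x) ` (SIGMA e:edges \<Gamma>. T e)"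
  have ep: "edge_point \<Gamma> e x = Inner e x" if "x \<in> T e" for e x
    using that by (auto simp: T_def edge_point_def)
  have Jsub: "J \<subseteq> level s"
    by (auto simp: J_def level_def points_def T_def edge_point_def)
  have Jinj: "inj_on (\<lambda>(e, x). Inner e x :: ('v, 'e) point) (SIGMA e:edges \<Gamma>. T e)"
    by (auto simp: inj_on_def)
  have finS: "finite (SIGMA e:edges \<Gamma>. T e)"
    using finite_subset[OF Jsub fin] finite_imageD[OF _ Jinj] unfolding J_def by blast
  show finT: "finite (T e)" if "e \<in> edges \<Gamma>" for e
  proof -
    have "T e = snd ` ({e} \<times> T e)" by force
    moreover have "{e} \<times> T e \<subseteq> (SIGMA e:edges \<Gamma>. T e)" using that by auto
    ultimately show ?thesis using finS by (metis finite_imageI finite_subset)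
  qed
  have "(\<Sum>p\<in>level s. (\<phi> p)\<^sup>2) = (\<Sum>p\<in>J. (\<phi> p)\<^sup>2)"
  proof (rule sum.mono_neutral_right[OF fin Jsub], rule ballI)
    fix p assume p: "p \<in> level s - J"
    then consider w where "p = Vertex w" "w \<in> vertices \<Gamma>"
      | e x where "p = Inner e x" "e \<in> edges \<Gamma>" "0 < x" "x < len \<Gamma> e"
      by (auto simp: level_def points_def)
    then show "(\<phi> p)\<^sup>2 = 0"
    proof cases
      case 1
      then show ?thesis using p off[of w] by (auto simp: level_def)
    next
      case 2
      then have "x \<in> T e" using p by (auto simp: level_def T_def edge_point_def)
      with 2 have "p \<in> J" by (auto simp: J_def image_iff)
      with p show ?thesis by simp
    qed
  qed
  also have "\<dots> = (\<Sum>(e, x)\<in>(SIGMA e:edges \<Gamma>. T e). (\<phi> (Inner e x))\<^sup>2)"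
    unfolding J_def by (subst sum.reindex[OF Jinj]) (simp add: case_prod_unfold)
  also have "\<dots> = (\<Sum>e\<in>edges \<Gamma>. \<Sum>x\<in>T e. (\<phi> (Inner e x))\<^sup>2)"
    by (rule sum.Sigma[symmetric]) (use finT finite_edges[OF \<Gamma>] in auto)
  also have "\<dots> = (\<Sum>e\<in>edges \<Gamma>. \<Sum>x\<in>T e. (\<phi> (edge_point \<Gamma> e x))\<^sup>2)"
    by (intro sum.cong refl) (simp add: ep)
  finally show "(\<Sum>p\<in>level s. (\<phi> p)\<^sup>2) = (\<Sum>e\<in>edges \<Gamma>. \<Sum>x\<in>T e. (\<phi> (edge_point \<Gamma> e x))\<^sup>2)" .
qed

text \<open>The coarea inequality for \<open>G = (\<psi>\<^sub>+ / \<phi>)\<^sup>2\<close> and \<open>k = \<phi>\<^sup>2\<close>, whose right-hand side is the integral of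
  \<open>2 \<psi>\<^sub>+ \<bar>\<psi>' - \<psi> \<phi>' / \<phi>\<bar>\<close>; this is split by Young's inequality with a parameter \<open>c\<close>.\<close>

lemma coarea_edge:
  assumes e: "e \<in> edges \<Gamma>" and c: "0 < c"
  obtains N :: "real \<Rightarrow> ennreal" where "N \<in> borel_measurable borel"
    "\<And>t T. \<lbrakk>0 < t; finite T; T \<subseteq> {x \<in> {0<..<len \<Gamma> e}. \<psi> (edge_point \<Gamma> e x) = sqrt t * \<phi> (edge_point \<Gamma> e x)}\<rbrakk>
      \<Longrightarrow> ennreal (\<Sum>x\<in>T. (\<phi> (edge_point \<Gamma> e x))\<^sup>2) \<le> N t"
    "(\<integral>\<^sup>+ t. N t \<partial>lborel) \<le>
      ennreal (c * (\<integral>x. (max 0 (\<psi> (edge_point \<Gamma> e x)))\<^sup>2 \<partial>lebesgue_on {0..len \<Gamma> e}))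
      + ennreal (1 / c) * (\<integral>\<^sup>+ x. ennreal ((\<psi>' e x - \<psi> (edge_point \<Gamma> e x) * \<phi>' e x / \<phi> (edge_point \<Gamma> e x))\<^sup>2)
         * indicator {x \<in> {0<..<len \<Gamma> e}. \<psi> (edge_point \<Gamma> e x) > 0} x \<partial>lborel)"
proof -
  define l where "l = len \<Gamma> e"
  define F where "F = (\<lambda>x. \<phi> (edge_point \<Gamma> e x))"
  define m where "m = (\<lambda>x. max 0 (\<psi> (edge_point \<Gamma> e x)))"
  define P where "P = {x \<in> {0<..<l}. \<psi> (edge_point \<Gamma> e x) > 0}"
  define w where "w = (\<lambda>x. \<psi>' e x - m x * \<phi>' e x / F x)"
  define G where "G = (\<lambda>x. (m x)\<^sup>2 / (F x)\<^sup>2)"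
  define G' where "G' = (\<lambda>x. 2 * m x * w x / (F x)\<^sup>2)"
  have l: "0 < l" unfolding l_def by (rule len_pos[OF \<Gamma> e])
  have Fpos: "F x > 0" if "x \<in> {0<..<l}" for x
    using \<phi>_pos_edge[OF e] that by (simp add: F_def l_def)
  have sub: "{0<..<l} \<subseteq> {0..len \<Gamma> e}" by (auto simp: l_def)
  note cont = continuous_on_subset[OF continuous_on_edge(1)[OF e] sub]
    continuous_on_subset[OF continuous_on_edge(2)[OF e] sub]
    continuous_on_subset[OF continuous_on_edge(3)[OF e] sub]
    continuous_on_subset[OF continuous_on_edge(4)[OF e] sub]
  have Fc: "continuous_on {0<..<l} F" unfolding F_def by (rule cont)
  have mc: "continuous_on {0<..<l} m" unfolding m_def by (intro continuous_intros cont)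
  have F0: "\<forall>x\<in>{0<..<l}. F x \<noteq> 0" using Fpos by force
  have wc: "continuous_on {0<..<l} w"
    unfolding w_def by (intro continuous_intros cont mc Fc F0)
  have dG: "(G has_real_derivative G' x) (at x)" if x: "x \<in> {0<..<l}" for x
  proof -
    have at: "at x within {0..len \<Gamma> e} = at x" using x by (intro at_within_Icc_at) (auto simp: l_def)
    have x': "x \<in> {0..len \<Gamma> e}" using x sub by blast
    have dF: "(F has_real_derivative \<phi>' e x) (at x)" using d\<phi>[OF e x'] unfolding F_def at .
    have "((\<lambda>x. \<psi> (edge_point \<Gamma> e x)) has_real_derivative \<psi>' e x) (at x)" using d\<psi>[OF e x'] unfolding at .
    from DERIV_chain2[OF has_real_derivative_max0_square this]
    have dm: "((\<lambda>x. (m x)\<^sup>2) has_real_derivative 2 * m x * \<psi>' e x) (at x)" by (simp add: m_def)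
    have dF2: "((\<lambda>x. (F x)\<^sup>2) has_real_derivative 2 * F x * \<phi>' e x) (at x)"
      using dF by (auto intro!: derivative_eq_intros)
    have F0: "F x \<noteq> 0" using Fpos[OF x] by simp
    have "(2 * m x * \<psi>' e x * (F x)\<^sup>2 - (m x)\<^sup>2 * (2 * F x * \<phi>' e x)) / ((F x)\<^sup>2 * (F x)\<^sup>2) = G' x"
      unfolding G'_def w_def using F0 by (simp add: field_simps power2_eq_square)
    then show ?thesis
      using DERIV_divide[OF dm dF2] F0 unfolding G_def by simp
  qed
  obtain N where N: "N \<in> borel_measurable borel"
    "\<And>t T. \<lbrakk>finite T; T \<subseteq> {x \<in> {0<..<l}. G x = t}\<rbrakk> \<Longrightarrow> ennreal (\<Sum>x\<in>T. (F x)\<^sup>2) \<le> N t"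
    "(\<integral>\<^sup>+ t. N t \<partial>lborel) \<le> (\<integral>\<^sup>+ x. ennreal ((F x)\<^sup>2 * \<bar>G' x\<bar>) * indicator {0<..<l} x \<partial>lborel)"
  proof (rule coarea_inequality[OF l dG])
    show "continuous_on {0<..<l} G'" unfolding G'_def by (intro continuous_intros mc wc Fc) (use F0 in simp)
    show "continuous_on {0<..<l} (\<lambda>x. (F x)\<^sup>2)" by (intro continuous_intros Fc)
  qed (auto intro: that)
  define Q where "Q = (\<lambda>x. (\<psi>' e x - \<psi> (edge_point \<Gamma> e x) * \<phi>' e x / F x)\<^sup>2)"
  have young: "ennreal ((F x)\<^sup>2 * \<bar>G' x\<bar>) * indicator {0<..<l} x
      \<le> ennreal (c * (m x)\<^sup>2) * indicator {0..l} x + ennreal (1 / c) * (ennreal (Q x) * indicator P x)" for x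
  proof (cases "x \<in> {0<..<l}")
    case x: True
    have k: "(F x)\<^sup>2 * \<bar>G' x\<bar> = 2 * m x * \<bar>w x\<bar>"
      using Fpos[OF x] by (simp add: G'_def abs_mult m_def)
    show ?thesis
    proof (cases "x \<in> P")
      case True
      have "0 \<le> (c * m x - \<bar>w x\<bar>)\<^sup>2 / c" using c by simp
      also have "(c * a - b)\<^sup>2 / c = c * a\<^sup>2 + b\<^sup>2 / c - 2 * a * b" for a b
        using c by (simp add: power2_eq_square field_simps)
      finally have y: "2 * m x * \<bar>w x\<bar> \<le> c * (m x)\<^sup>2 + (1 / c) * Q x"
        using True by (simp add: Q_def w_def m_def P_def)
      have "ennreal ((F x)\<^sup>2 * \<bar>G' x\<bar>) \<le> ennreal (c * (m x)\<^sup>2 + (1 / c) * Q x)"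
        unfolding k by (rule ennreal_leI[OF y])
      also have "\<dots> = ennreal (c * (m x)\<^sup>2) + ennreal (1 / c) * ennreal (Q x)"
        using c by (simp add: Q_def ennreal_plus ennreal_mult'[symmetric])
      finally show ?thesis using x True by simp
    next
      case False
      then have "m x = 0" using x by (auto simp: m_def P_def)
      then show ?thesis by (simp add: G'_def)
    qed
  qed simp
  have Qm: "(\<lambda>x. ennreal (Q x) * indicator P x) \<in> borel_measurable borel"
  proof -
    have "open ({0<..<l} \<inter> (\<lambda>x. \<psi> (edge_point \<Gamma> e x)) -` {0<..})"
      by (rule continuous_open_preimage[OF cont(3)]) auto
    moreover have "{0<..<l} \<inter> (\<lambda>x. \<psi> (edge_point \<Gamma> e x)) -` {0<..} = P" by (auto simp: P_def)
    ultimately have "open P" by simp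
    have "continuous_on {0<..<l} Q"
      unfolding Q_def by (intro continuous_intros cont Fc F0)
    then have "continuous_on P Q" by (rule continuous_on_subset) (auto simp: P_def)
    with \<open>open P\<close> show ?thesis by (intro borel_measurable_ennreal_indicator) auto
  qed
  have m2: "continuous_on {0..l} (\<lambda>x. c * (m x)\<^sup>2)"
    unfolding m_def l_def by (intro continuous_intros continuous_on_edge[OF e])
  have m2m: "(\<lambda>x. ennreal (c * (m x)\<^sup>2) * indicator {0..l} x) \<in> borel_measurable borel"
    by (rule borel_measurable_ennreal_indicator[OF _ m2]) simp
  have "(\<integral>\<^sup>+ t. N t \<partial>lborel) \<le> (\<integral>\<^sup>+ x. ennreal ((F x)\<^sup>2 * \<bar>G' x\<bar>) * indicator {0<..<l} x \<partial>lborel)"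
    by (rule N(3))
  also have "\<dots> \<le> (\<integral>\<^sup>+ x. ennreal (c * (m x)\<^sup>2) * indicator {0..l} x
      + ennreal (1 / c) * (ennreal (Q x) * indicator P x) \<partial>lborel)"
    by (intro nn_integral_mono young)
  also have "\<dots> = (\<integral>\<^sup>+ x. ennreal (c * (m x)\<^sup>2) * indicator {0..l} x \<partial>lborel)
      + ennreal (1 / c) * (\<integral>\<^sup>+ x. ennreal (Q x) * indicator P x \<partial>lborel)"
    using Qm m2m by (subst nn_integral_add) (auto simp: nn_integral_cmult)
  also have "(\<integral>\<^sup>+ x. ennreal (c * (m x)\<^sup>2) * indicator {0..l} x \<partial>lborel)
      = ennreal (\<integral>x. c * (m x)\<^sup>2 \<partial>lebesgue_on {0..l})"
    using c by (intro nn_integral_eq_lebesgue_on m2) simp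
  also have "(\<integral>x. c * (m x)\<^sup>2 \<partial>lebesgue_on {0..l}) = c * (\<integral>x. (m x)\<^sup>2 \<partial>lebesgue_on {0..l})"
    by simp
  finally have N3: "(\<integral>\<^sup>+ t. N t \<partial>lborel) \<le> ennreal (c * (\<integral>x. (m x)\<^sup>2 \<partial>lebesgue_on {0..l}))
      + ennreal (1 / c) * (\<integral>\<^sup>+ x. ennreal (Q x) * indicator P x \<partial>lborel)" .
  show thesis
  proof (rule that[OF N(1)])
    fix t T assume t: "0 < t" and T: "finite T"
      "T \<subseteq> {x \<in> {0<..<len \<Gamma> e}. \<psi> (edge_point \<Gamma> e x) = sqrt t * \<phi> (edge_point \<Gamma> e x)}"
    have "G x = t" if "x \<in> T" for x
    proof -
      have x: "x \<in> {0<..<l}" "\<psi> (edge_point \<Gamma> e x) = sqrt t * F x"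
        using T(2) that by (auto simp: l_def F_def)
      have "0 < sqrt t * F x" using Fpos[OF x(1)] t by simp
      then have "m x = sqrt t * F x" using x(2) by (simp add: m_def)
      then show ?thesis using Fpos[OF x(1)] t by (simp add: G_def power_mult_distrib)
    qed
    then have "T \<subseteq> {x \<in> {0<..<l}. G x = t}" using T(2) by (auto simp: l_def)
    from N(2)[OF T(1) this] show "ennreal (\<Sum>x\<in>T. (\<phi> (edge_point \<Gamma> e x))\<^sup>2) \<le> N t"
      by (simp add: F_def)
  qed (use N3 in \<open>simp add: m_def l_def Q_def P_def F_def\<close>)
qed

lemma sq_norm_pos_part_nonneg: "0 \<le> sq_norm_pos_part"
  unfolding sq_norm_pos_part_def by (intro sum_nonneg Bochner_Integration.integral_nonneg) simp

text \<open>Integrate the Cheeger inequality over all levels. The parameter \<open>c\<close> of Young's inequality is chosen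
  such that its two terms become equal.\<close>

lemma cheeger_bound:
  assumes gap: "\<mu>\<^sub>1 < \<mu>\<^sub>2" and half: "mass (super_level 0) \<le> mass (sub_level 0)"
    and A: "0 < sq_norm_pos_part"
  shows "(cheeger \<Gamma> \<phi>)\<^sup>2 \<le> 4 * (\<mu>\<^sub>2 - \<mu>\<^sub>1)"
proof -
  let ?h = "cheeger \<Gamma> \<phi>"
  define c where "c = sqrt (\<mu>\<^sub>2 - \<mu>\<^sub>1)"
  have c: "0 < c" "c * c = \<mu>\<^sub>2 - \<mu>\<^sub>1" using gap by (auto simp: c_def)
  \<comment> \<open>some level yields a cut, so the infimum is over a nonempty set and hence nonnegative\<close>
  have "\<exists>t>0. 0 < mass (super_level (sqrt t))"
  proof (rule ccontr)
    assume "\<not> (\<exists>t>0. 0 < mass (super_level (sqrt t)))"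
    then have "mass (super_level (sqrt t)) = 0" if "0 < t" for t
      using that mass_nonneg by (metis order_less_le)
    then have "indicator {0<..} t * ennreal (mass (super_level (sqrt t))) = 0" for t
      by (auto split: split_indicator)
    with layer_cake(2) A show False by simp
  qed
  then obtain t where t: "0 < t" "0 < mass (super_level (sqrt t))" by blast
  have "is_cut \<Gamma> (level (sqrt t)) (super_level (sqrt t)) (sub_level (sqrt t))"
    by (rule level_cut(1)[OF gap _ half t(2)]) (use t in simp)
  then have h0: "0 \<le> ?h" by (rule cheeger_nonneg)
  define D where "D = (\<lambda>e. \<integral>x. (max 0 (\<psi> (edge_point \<Gamma> e x)))\<^sup>2 \<partial>lebesgue_on {0..len \<Gamma> e})"
  define W where "W = (\<lambda>e. \<integral>\<^sup>+ x. ennreal ((\<psi>' e x - \<psi> (edge_point \<Gamma> e x) * \<phi>' e x / \<phi> (edge_point \<Gamma> e x))\<^sup>2)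
         * indicator {x \<in> {0<..<len \<Gamma> e}. \<psi> (edge_point \<Gamma> e x) > 0} x \<partial>lborel)"
  define T where "T = (\<lambda>t e. {x \<in> {0<..<len \<Gamma> e}. \<psi> (edge_point \<Gamma> e x) = sqrt t * \<phi> (edge_point \<Gamma> e x)})"
  have "\<forall>e\<in>edges \<Gamma>. \<exists>N. N \<in> borel_measurable borel \<and>
     (\<forall>t T'. 0 < t \<longrightarrow> finite T' \<longrightarrow> T' \<subseteq> T t e \<longrightarrow> ennreal (\<Sum>x\<in>T'. (\<phi> (edge_point \<Gamma> e x))\<^sup>2) \<le> N t) \<and>
     (\<integral>\<^sup>+ t. N t \<partial>lborel) \<le> ennreal (c * D e) + ennreal (1 / c) * W e"
  proof
    fix e assume e: "e \<in> edges \<Gamma>"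
    show "\<exists>N. N \<in> borel_measurable borel \<and>
     (\<forall>t T'. 0 < t \<longrightarrow> finite T' \<longrightarrow> T' \<subseteq> T t e \<longrightarrow> ennreal (\<Sum>x\<in>T'. (\<phi> (edge_point \<Gamma> e x))\<^sup>2) \<le> N t) \<and>
     (\<integral>\<^sup>+ t. N t \<partial>lborel) \<le> ennreal (c * D e) + ennreal (1 / c) * W e"
    proof (rule coarea_edge[OF e c(1)])
      fix N :: "real \<Rightarrow> ennreal"
      assume N: "N \<in> borel_measurable borel"
        and le: "\<And>t T'. \<lbrakk>0 < t; finite T'; T' \<subseteq> {x \<in> {0<..<len \<Gamma> e}. \<psi> (edge_point \<Gamma> e x) = sqrt t * \<phi> (edge_point \<Gamma> e x)}\<rbrakk>
          \<Longrightarrow> ennreal (\<Sum>x\<in>T'. (\<phi> (edge_point \<Gamma> e x))\<^sup>2) \<le> N t"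
        and int: "(\<integral>\<^sup>+ t. N t \<partial>lborel) \<le>
          ennreal (c * (\<integral>x. (max 0 (\<psi> (edge_point \<Gamma> e x)))\<^sup>2 \<partial>lebesgue_on {0..len \<Gamma> e}))
          + ennreal (1 / c) * (\<integral>\<^sup>+ x. ennreal ((\<psi>' e x - \<psi> (edge_point \<Gamma> e x) * \<phi>' e x / \<phi> (edge_point \<Gamma> e x))\<^sup>2)
             * indicator {x \<in> {0<..<len \<Gamma> e}. \<psi> (edge_point \<Gamma> e x) > 0} x \<partial>lborel)"
      show ?thesis
        unfolding T_def D_def W_def
        by (intro exI[of _ N] conjI allI impI N int) (rule le)
    qed
  qed
  from bchoice[OF this] obtain N where "\<forall>e\<in>edges \<Gamma>. N e \<in> borel_measurable borel \<and>
     (\<forall>t T'. 0 < t \<longrightarrow> finite T' \<longrightarrow> T' \<subseteq> T t e \<longrightarrow> ennreal (\<Sum>x\<in>T'. (\<phi> (edge_point \<Gamma> e x))\<^sup>2) \<le> N e t) \<and>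
     (\<integral>\<^sup>+ t. N e t \<partial>lborel) \<le> ennreal (c * D e) + ennreal (1 / c) * W e" ..
  then have N: "\<And>e. e \<in> edges \<Gamma> \<Longrightarrow> N e \<in> borel_measurable borel"
    "\<And>e t T'. \<lbrakk>e \<in> edges \<Gamma>; 0 < t; finite T'; T' \<subseteq> T t e\<rbrakk> \<Longrightarrow> ennreal (\<Sum>x\<in>T'. (\<phi> (edge_point \<Gamma> e x))\<^sup>2) \<le> N e t"
    "\<And>e. e \<in> edges \<Gamma> \<Longrightarrow> (\<integral>\<^sup>+ t. N e t \<partial>lborel) \<le> ennreal (c * D e) + ennreal (1 / c) * W e"
    by blast+
  \<comment> \<open>the squares of the finitely many levels attained at vertices; they are discarded as a null set\<close>
  define X where "X = (\<lambda>w. (\<psi> (Vertex w) / \<phi> (Vertex w))\<^sup>2) ` vertices \<Gamma>"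
  have X: "finite X" unfolding X_def using finite_vertices[OF \<Gamma>] by simp
  have point: "ennreal ?h * (indicator {0<..} t * ennreal (mass (super_level (sqrt t)))) \<le> (\<Sum>e\<in>edges \<Gamma>. N e t)"
    if "t \<notin> X" for t
  proof (cases "0 < t")
    case t: True
    then have s: "0 < sqrt t" by simp
    have off: "\<psi> (Vertex w) \<noteq> sqrt t * \<phi> (Vertex w)" if "w \<in> vertices \<Gamma>" "\<phi> (Vertex w) \<noteq> 0" for w
    proof
      assume "\<psi> (Vertex w) = sqrt t * \<phi> (Vertex w)"
      then have "t = (\<psi> (Vertex w) / \<phi> (Vertex w))\<^sup>2" using that t by simp
      with that \<open>t \<notin> X\<close> show False by (auto simp: X_def)
    qed
    have sum: "(\<Sum>p\<in>level (sqrt t). (\<phi> p)\<^sup>2) = (\<Sum>e\<in>edges \<Gamma>. \<Sum>x\<in>T t e. (\<phi> (edge_point \<Gamma> e x))\<^sup>2)"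
      unfolding T_def by (rule level_sum(1)[OF off finite_level[OF gap s]])
    have finT: "finite (T t e)" if "e \<in> edges \<Gamma>" for e
      unfolding T_def by (rule level_sum(2)[OF off finite_level[OF gap s] that])
    have "ennreal ?h * (indicator {0<..} t * ennreal (mass (super_level (sqrt t)))) = ennreal (?h * mass (super_level (sqrt t)))"
      using t h0 mass_nonneg by (simp add: ennreal_mult)
    also have "\<dots> \<le> ennreal (\<Sum>p\<in>level (sqrt t). (\<phi> p)\<^sup>2)"
      by (rule ennreal_leI[OF cheeger_level[OF gap s half]])
    also have "\<dots> = ennreal (\<Sum>e\<in>edges \<Gamma>. \<Sum>x\<in>T t e. (\<phi> (edge_point \<Gamma> e x))\<^sup>2)"
      by (simp only: sum)
    also have "\<dots> = (\<Sum>e\<in>edges \<Gamma>. ennreal (\<Sum>x\<in>T t e. (\<phi> (edge_point \<Gamma> e x))\<^sup>2))"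
      by (rule sum_ennreal[symmetric]) (simp add: sum_nonneg)
    also have "\<dots> \<le> (\<Sum>e\<in>edges \<Gamma>. N e t)"
      by (intro sum_mono N(2) t finT order_refl)
    finally show ?thesis .
  qed simp
  have "ennreal (?h * sq_norm_pos_part) = ennreal ?h * (\<integral>\<^sup>+ t. indicator {0<..} t * ennreal (mass (super_level (sqrt t))) \<partial>lborel)"
    unfolding layer_cake(2) using h0 sq_norm_pos_part_nonneg by (simp add: ennreal_mult)
  also have "\<dots> = (\<integral>\<^sup>+ t. ennreal ?h * (indicator {0<..} t * ennreal (mass (super_level (sqrt t)))) \<partial>lborel)"
    by (rule nn_integral_cmult[symmetric]) (use layer_cake(1) in simp)
  also have "\<dots> \<le> (\<integral>\<^sup>+ t. (\<Sum>e\<in>edges \<Gamma>. N e t) \<partial>lborel)"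
  proof (rule nn_integral_mono_AE)
    have "AE t in lborel. t \<notin> X"
      by (rule AE_not_in[OF finite_imp_null_set_lborel[OF X]])
    then show "AE t in lborel. ennreal ?h * (indicator {0<..} t * ennreal (mass (super_level (sqrt t)))) \<le> (\<Sum>e\<in>edges \<Gamma>. N e t)"
      by (rule AE_mp) (intro AE_I2 impI point)
  qed
  also have "\<dots> = (\<Sum>e\<in>edges \<Gamma>. \<integral>\<^sup>+ t. N e t \<partial>lborel)"
    by (rule nn_integral_sum) (use N(1) in simp)
  also have "\<dots> \<le> (\<Sum>e\<in>edges \<Gamma>. ennreal (c * D e) + ennreal (1 / c) * W e)"
    by (intro sum_mono N(3))
  also have "\<dots> = (\<Sum>e\<in>edges \<Gamma>. ennreal (c * D e)) + ennreal (1 / c) * (\<Sum>e\<in>edges \<Gamma>. W e)"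
    by (simp add: sum.distrib sum_distrib_left)
  also have "(\<Sum>e\<in>edges \<Gamma>. ennreal (c * D e)) = ennreal (c * sq_norm_pos_part)"
    unfolding sq_norm_pos_part_def D_def using c
    by (subst sum_ennreal) (auto simp: sum_distrib_left intro!: mult_nonneg_nonneg Bochner_Integration.integral_nonneg)
  also have "ennreal (1 / c) * (\<Sum>e\<in>edges \<Gamma>. W e) \<le> ennreal (1 / c) * ennreal ((\<mu>\<^sub>2 - \<mu>\<^sub>1) * sq_norm_pos_part)"
    unfolding W_def by (intro mult_left_mono picone_energy) simp
  also have "ennreal (1 / c) * ennreal ((\<mu>\<^sub>2 - \<mu>\<^sub>1) * sq_norm_pos_part) = ennreal (c * sq_norm_pos_part)"
    using c A by (subst ennreal_mult'[symmetric]) (auto simp: field_simps c(2)[symmetric])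
  also have "ennreal (c * sq_norm_pos_part) + ennreal (c * sq_norm_pos_part) = ennreal (2 * c * sq_norm_pos_part)"
    using c A by (simp add: ennreal_plus[symmetric] del: ennreal_plus)
  finally have "?h * sq_norm_pos_part \<le> 2 * c * sq_norm_pos_part"
    using c A by (simp add: ennreal_le_iff)
  then have "?h \<le> 2 * c" using A by simp
  then have "?h\<^sup>2 \<le> (2 * c)\<^sup>2" using h0 by (rule power_mono)
  also have "\<dots> = 4 * (\<mu>\<^sub>2 - \<mu>\<^sub>1)" using c(2) by (simp add: power2_eq_square)
  finally show ?thesis .
qed

text \<open>Otherwise \<open>\<psi> \<le> 0\<close>; as \<open>\<psi>\<close> is orthogonal to \<open>\<phi>\<close>, this makes \<open>\<phi> \<psi>\<close> vanish, and then \<open>\<psi>\<close>.\<close>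

lemma sq_norm_pos_part_pos:
  assumes neq: "\<mu>\<^sub>1 \<noteq> \<mu>\<^sub>2" and nz: "\<psi> p \<noteq> 0"
  shows "0 < sq_norm_pos_part"
proof (rule ccontr)
  assume "\<not> 0 < sq_norm_pos_part"
  then have "sq_norm_pos_part = 0" using sq_norm_pos_part_nonneg by simp
  moreover have "sq_norm_pos_part = 0 \<longleftrightarrow>
      (\<forall>e\<in>edges \<Gamma>. (\<integral>x. (max 0 (\<psi> (edge_point \<Gamma> e x)))\<^sup>2 \<partial>lebesgue_on {0..len \<Gamma> e}) = 0)"
    unfolding sq_norm_pos_part_def
    by (rule sum_nonneg_eq_0_iff[OF finite_edges[OF \<Gamma>]]) (rule Bochner_Integration.integral_nonneg, simp)
  ultimately have "(\<integral>x. (max 0 (\<psi> (edge_point \<Gamma> e x)))\<^sup>2 \<partial>lebesgue_on {0..len \<Gamma> e}) = 0" if "e \<in> edges \<Gamma>" for e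
    using that by blast
  note zero = this
  have neg: "\<psi> (edge_point \<Gamma> e x) \<le> 0" if e: "e \<in> edges \<Gamma>" and x: "x \<in> {0..len \<Gamma> e}" for e x
  proof -
    have "continuous_on {0..len \<Gamma> e} (\<lambda>x. (max 0 (\<psi> (edge_point \<Gamma> e x)))\<^sup>2)"
      by (intro continuous_intros continuous_on_edge[OF e])
    from zero_integral_imp_zero[OF len_pos[OF \<Gamma> e] this _ zero[OF e] x]
    have "(max 0 (\<psi> (edge_point \<Gamma> e x)))\<^sup>2 = 0" by simp
    then have "max 0 (\<psi> (edge_point \<Gamma> e x)) = 0" unfolding zero_eq_power2 .
    then show ?thesis by (simp add: max_def split: if_splits)
  qed
  let ?I = "\<lambda>e. \<integral>x. \<phi> (edge_point \<Gamma> e x) * - \<psi> (edge_point \<Gamma> e x) \<partial>lebesgue_on {0..len \<Gamma> e}"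
  have nn: "0 \<le> ?I e" if "e \<in> edges \<Gamma>" for e
    using neg[OF that] by (intro Bochner_Integration.integral_nonneg_AE AE_I2 mult_nonneg_nonneg \<phi>_nonneg) simp
  have "(\<Sum>e\<in>edges \<Gamma>. ?I e) = 0"
    using orthogonal[OF neq] by (simp add: sum_negf)
  then have I0: "?I e = 0" if "e \<in> edges \<Gamma>" for e
    using sum_nonneg_eq_0_iff[OF finite_edges[OF \<Gamma>], of ?I] nn that by blast
  have prod0: "\<phi> (edge_point \<Gamma> e x) * - \<psi> (edge_point \<Gamma> e x) = 0" if "e \<in> edges \<Gamma>" "x \<in> {0..len \<Gamma> e}" for e x
  proof (rule zero_integral_imp_zero[OF len_pos[OF \<Gamma> that(1)] _ _ I0[OF that(1)] that(2)])
    show "continuous_on {0..len \<Gamma> e} (\<lambda>x. \<phi> (edge_point \<Gamma> e x) * - \<psi> (edge_point \<Gamma> e x))"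
      by (intro continuous_intros continuous_on_edge that)
    show "0 \<le> \<phi> (edge_point \<Gamma> e x) * - \<psi> (edge_point \<Gamma> e x)" if x: "x \<in> {0..len \<Gamma> e}" for x
      using neg[OF \<open>e \<in> edges \<Gamma>\<close> x] by (intro mult_nonneg_nonneg \<phi>_nonneg) simp
  qed
  have "p \<in> points \<Gamma>" using form_domain_zero(1)[OF eigenfunctions_dom(2)] nz by blast
  then obtain e x where ex: "e \<in> edges \<Gamma>" "x \<in> {0..len \<Gamma> e}" "p = edge_point \<Gamma> e x"
    by (rule edge_covering[OF \<Gamma>])
  then show False using prod0[OF ex(1,2)] nz \<phi>_zero_imp by auto
qed

end

section \<open>The spectral gap\<close>

lemma eigenspace_minus:
  assumes \<Gamma>: "is_metric_graph \<Gamma>" and u: "u \<in> eigenspace \<Gamma> \<mu>"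
  shows "(\<lambda>p. - u p) \<in> eigenspace \<Gamma> \<mu>"
proof -
  have ud: "u \<in> form_domain \<Gamma>" and weak: "\<And>v. v \<in> form_domain \<Gamma> \<Longrightarrow> energy_form \<Gamma> u v = L2_inner \<Gamma> (\<lambda>p. \<mu> * u p) v"
    and L2: "(\<lambda>p. \<mu> * u p) \<in> graph_L2 \<Gamma>"
    using u unfolding eigenspace_def neg_laplacian_def by auto
  have ex: "\<exists>g. \<forall>e\<in>edges \<Gamma>. has_L2_derivative (len \<Gamma> e) (v \<circ> edge_point \<Gamma> e) (g e)" if "v \<in> form_domain \<Gamma>" for v
    using that unfolding form_domain_def graph_H1_def by (auto intro: bchoice)
  obtain g where g: "\<And>e. e \<in> edges \<Gamma> \<Longrightarrow> has_L2_derivative (len \<Gamma> e) (u \<circ> edge_point \<Gamma> e) (g e)"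
    using ex[OF ud] by blast
  have g': "has_L2_derivative (len \<Gamma> e) ((\<lambda>p. - u p) \<circ> edge_point \<Gamma> e) (\<lambda>x. - g e x)" if "e \<in> edges \<Gamma>" for e
    using L2_derivative_diff[OF has_L2_derivative_zero g[OF that]] by (simp add: comp_def)
  have "(\<lambda>p. - u p) \<in> form_domain \<Gamma>"
    by (rule form_domainI[OF \<Gamma> g']) (use ud in \<open>auto simp: form_domain_def graph_H1_def\<close>)
  moreover have "(\<lambda>p. \<mu> * - u p) \<in> graph_L2 \<Gamma>"
    using L2 by (simp add: graph_L2_def square_integrable_on_def comp_def)
  moreover have "energy_form \<Gamma> (\<lambda>p. - u p) v = L2_inner \<Gamma> (\<lambda>p. \<mu> * - u p) v" if v: "v \<in> form_domain \<Gamma>" for v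
  proof -
    obtain h where h: "\<And>e. e \<in> edges \<Gamma> \<Longrightarrow> has_L2_derivative (len \<Gamma> e) (v \<circ> edge_point \<Gamma> e) (h e)"
      using ex[OF v] by blast
    have "energy_form \<Gamma> (\<lambda>p. - u p) v = - energy_form \<Gamma> u v"
      using energy_form_eq[OF \<Gamma> g' h] energy_form_eq[OF \<Gamma> g h] by (simp add: sum_negf)
    also have "\<dots> = L2_inner \<Gamma> (\<lambda>p. \<mu> * - u p) v"
      using weak[OF v] by (simp add: L2_inner_def sum_negf)
    finally show ?thesis .
  qed
  ultimately show ?thesis unfolding eigenspace_def neg_laplacian_def by blast
qed

lemma eigenfunction_pair_exists:
  assumes "is_metric_graph \<Gamma>" "\<phi> \<in> eigenspace \<Gamma> \<mu>\<^sub>1" "\<psi> \<in> eigenspace \<Gamma> \<mu>\<^sub>2"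
    and "\<forall>p \<in> points \<Gamma> - Vertex ` dirichlet \<Gamma>. \<phi> p > 0"
  obtains \<phi>' \<psi>' where "eigenfunction_pair \<Gamma> \<mu>\<^sub>1 \<mu>\<^sub>2 \<phi> \<psi> \<phi>' \<psi>'"
proof -
  have ex: "\<exists>u'. \<forall>e\<in>edges \<Gamma>. (\<forall>x\<in>{0..len \<Gamma> e}.
      ((\<lambda>x. u (edge_point \<Gamma> e x)) has_real_derivative u' e x) (at x within {0..len \<Gamma> e}) \<and>
      (u' e has_real_derivative - \<mu> * u (edge_point \<Gamma> e x)) (at x within {0..len \<Gamma> e}))"
    if u: "u \<in> eigenspace \<Gamma> \<mu>" for u \<mu>
  proof (rule bchoice, rule ballI)
    fix e assume e: "e \<in> edges \<Gamma>"
    show "\<exists>u'. \<forall>x\<in>{0..len \<Gamma> e}.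
      ((\<lambda>x. u (edge_point \<Gamma> e x)) has_real_derivative u' x) (at x within {0..len \<Gamma> e}) \<and>
      (u' has_real_derivative - \<mu> * u (edge_point \<Gamma> e x)) (at x within {0..len \<Gamma> e})"
      by (rule eigenfunction_classical[OF assms(1) u e]) (unfold comp_def, blast)
  qed
  obtain \<phi>' \<psi>' where "\<forall>e\<in>edges \<Gamma>. (\<forall>x\<in>{0..len \<Gamma> e}.
      ((\<lambda>x. \<phi> (edge_point \<Gamma> e x)) has_real_derivative \<phi>' e x) (at x within {0..len \<Gamma> e}) \<and>
      (\<phi>' e has_real_derivative - \<mu>\<^sub>1 * \<phi> (edge_point \<Gamma> e x)) (at x within {0..len \<Gamma> e}))"
    "\<forall>e\<in>edges \<Gamma>. (\<forall>x\<in>{0..len \<Gamma> e}.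
      ((\<lambda>x. \<psi> (edge_point \<Gamma> e x)) has_real_derivative \<psi>' e x) (at x within {0..len \<Gamma> e}) \<and>
      (\<psi>' e has_real_derivative - \<mu>\<^sub>2 * \<psi> (edge_point \<Gamma> e x)) (at x within {0..len \<Gamma> e}))"
    using ex[OF assms(2)] ex[OF assms(3)] by blast
  then show thesis
    using assms by (intro that[of \<phi>' \<psi>']) (unfold_locales, blast+)
qed

lemma listed_eigenvalue_has_eigenfunction:
  assumes "lists_eigenvalues \<Gamma> ev" "1 \<le> k"
  obtains u p where "u \<in> eigenspace \<Gamma> (ev k)" "u p \<noteq> 0"
proof -
  let ?K = "{j. 1 \<le> j \<and> ev j = ev k}"
  have "finite ?K" "card ?K = eigenvalue_multiplicity \<Gamma> (ev k)"
    using assms(1) unfolding lists_eigenvalues_def by blast+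
  moreover have "k \<in> ?K" using assms(2) by simp
  ultimately have "eigenvalue_multiplicity \<Gamma> (ev k) \<noteq> 0" by (metis card_gt_0_iff empty_iff less_numeral_extra(3))
  moreover have "eigenvalue_multiplicity \<Gamma> (ev k) = 0" if "eigenspace \<Gamma> (ev k) \<subseteq> {\<lambda>p. 0}"
  proof -
    have "point_functions.dim (eigenspace \<Gamma> (ev k)) = 0"
    proof (rule point_functions.dim_unique[of "{}"])
      show "eigenspace \<Gamma> (ev k) \<subseteq> point_functions.span {}"
        using that by (simp add: point_functions.span_empty zero_fun_def)
    qed (auto simp: point_functions.independent_empty)
    then show ?thesis by (simp add: eigenvalue_multiplicity_def)
  qed
  ultimately have "\<not> eigenspace \<Gamma> (ev k) \<subseteq> {\<lambda>p. 0}" by auto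
  then obtain u where "u \<in> eigenspace \<Gamma> (ev k)" "u \<noteq> (\<lambda>p. 0)" by blast
  then show thesis using that by fastforce
qed

theorem theorem2p1:
  fixes \<Gamma> :: "('v, 'e) metric_graph"
    and ev :: "nat \<Rightarrow> real"
    and \<phi>\<^sub>1 :: "('v, 'e) point \<Rightarrow> real"
  assumes "is_metric_graph \<Gamma>"
    and "lists_eigenvalues \<Gamma> ev"
    and "ev 1 < ev 2"
    and "\<phi>\<^sub>1 \<in> eigenspace \<Gamma> (ev 1)"
    and "\<forall>p \<in> points \<Gamma> - Vertex ` dirichlet \<Gamma>. \<phi>\<^sub>1 p > 0"
  shows "ev 2 - ev 1 \<ge> 1 / 4 * (cheeger \<Gamma> \<phi>\<^sub>1)\<^sup>2"
proof -
  have *: "(cheeger \<Gamma> \<phi>\<^sub>1)\<^sup>2 \<le> 4 * (ev 2 - ev 1)"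
    if u: "u \<in> eigenspace \<Gamma> (ev 2)" "u p \<noteq> 0"
      and half: "integral_over \<Gamma> {p \<in> points \<Gamma>. u p > 0} (\<lambda>p. (\<phi>\<^sub>1 p)\<^sup>2)
        \<le> integral_over \<Gamma> {p \<in> points \<Gamma>. u p < 0} (\<lambda>p. (\<phi>\<^sub>1 p)\<^sup>2)" for u p
  proof -
    obtain \<phi>' u' where "eigenfunction_pair \<Gamma> (ev 1) (ev 2) \<phi>\<^sub>1 u \<phi>' u'"
      by (rule eigenfunction_pair_exists[OF assms(1,4) u(1) assms(5)])
    then interpret eigenfunction_pair \<Gamma> "ev 1" "ev 2" \<phi>\<^sub>1 u \<phi>' u' .
    show ?thesis
      using assms(3) half sq_norm_pos_part_pos[OF _ u(2)]
      by (intro cheeger_bound) (auto simp: mass_def super_level_def sub_level_def)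
  qed
  obtain \<psi> p where \<psi>: "\<psi> \<in> eigenspace \<Gamma> (ev 2)" "\<psi> p \<noteq> 0"
    by (rule listed_eigenvalue_has_eigenfunction[OF assms(2), of 2]) auto
  \<comment> \<open>one of \<open>\<psi>\<close> and \<open>- \<psi>\<close> is positive on the region of smaller mass\<close>
  have "(cheeger \<Gamma> \<phi>\<^sub>1)\<^sup>2 \<le> 4 * (ev 2 - ev 1)"
    using *[OF \<psi>] *[OF eigenspace_minus[OF assms(1) \<psi>(1)], of p] \<psi>(2)
    by (cases "integral_over \<Gamma> {p \<in> points \<Gamma>. \<psi> p > 0} (\<lambda>p. (\<phi>\<^sub>1 p)\<^sup>2)
        \<le> integral_over \<Gamma> {p \<in> points \<Gamma>. \<psi> p < 0} (\<lambda>p. (\<phi>\<^sub>1 p)\<^sup>2)") auto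
  then show ?thesis by simp
qed

end
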